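(* Let $1<p<\infty$ and let $T,T_0:\ell_p\to\ell_p$ be the bounded operators described in the context. Then $$\sigma_{ess}(T,\ell_p)=\sigma(T_0,\ell_p)=[r_1-2s_1,r_1+2s_1]\cup[r_2-2s_2,r_2+2s_2].$$
   Context: $\ell_p$ is the complex Banach space of $p$-summable sequences $x=\{x_n\}_{n\ge1}$. Let $r_1,r_2\ge0$ and $s_1,s_2>0$ be real. Let $\{a_n\}_{n\ge1}\subset\mathbb{C}$ and $\{b_n\}_{n\ge1},\{c_n\}_{n\ge1}\subset\mathbb{C}\setminus\{0\}$ be sequences with $a_{2n-1}\to r_1$, $b_{2n-1}\to s_1$, $c_{2n-1}\to s_1$, $a_{2n}\to r_2$, $b_{2n}\to s_2$, $c_{2n}\to s_2$. The operator $T$ is $(Tx)_n=c_{n-2}x_{n-2}+a_nx_n+b_nx_{n+2}$ for $n\ge1$, where the term $c_{n-2}x_{n-2}$ is omitted for $n=1,2$. The operator $T_0$ is $(T_0x)_n=s_1x_{n-2}+r_1x_n+s_1x_{n+2}$ for $n$ odd and $(T_0x)_n=s_2x_{n-2}+r_2x_n+s_2x_{n+2}$ for $n$ even, with $x_{-1}=x_0=0$. $\sigma(A,X)$ is the spectrum. An operator $A\in B(X)$ is Fredholm if its range $R(A)$ is closed and $\dim N(A)$, $\dim(X/R(A))$ are finite; $\sigma_{ess}(A,X)=\{\lambda\in\mathbb{C}:A-\lambda I\text{ is not Fredholm}\}$. *)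

theory Defs
  imports "HOL-Analysis.Analysis" "HOL-Library.Function_Algebras"
begin

text \<open>
  Sequences are indexed from \<open>1\<close>: a sequence \<open>(x\<^sub>n)\<close> with \<open>n \<ge> 1\<close> is represented by a
  function on \<^typ>\<open>nat\<close> that takes the value \<open>0\<close> at \<open>0\<close>. Addition, subtraction and zero of
  sequences are the pointwise ones.
\<close>

definition seq_scale :: "complex \<Rightarrow> (nat \<Rightarrow> complex) \<Rightarrow> (nat \<Rightarrow> complex)" where
  "seq_scale k x = (\<lambda>n. k * x n)"

interpretation seq: vector_space seq_scale
  by unfold_locales (auto simp: seq_scale_def fun_eq_iff algebra_simps)

definition lp :: "real \<Rightarrow> (nat \<Rightarrow> complex) set" where
  "lp p = {x. x 0 = 0 \<and> summable (\<lambda>n. norm (x n) powr p)}"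

definition lp_norm :: "real \<Rightarrow> (nat \<Rightarrow> complex) \<Rightarrow> real" where
  "lp_norm p x = (\<Sum>n. norm (x n) powr p) powr (1 / p)"

definition lp_dist :: "real \<Rightarrow> (nat \<Rightarrow> complex) \<Rightarrow> (nat \<Rightarrow> complex) \<Rightarrow> real" where
  "lp_dist p x y = lp_norm p (x - y)"

lemma lp_zero: "0 \<in> lp p"
  by (simp add: lp_def)

lemma lp_scale: "x \<in> lp p \<Longrightarrow> seq_scale k x \<in> lp p"
  by (auto simp: lp_def seq_scale_def norm_mult powr_mult intro: summable_mult)

lemma lp_norm_zero_iff:
  assumes "x \<in> lp p" "0 < p"
  shows "lp_norm p x = 0 \<longleftrightarrow> x = 0"
proof -
  have s: "summable (\<lambda>n. norm (x n) powr p)"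
    using assms by (simp add: lp_def)
  have "lp_norm p x = 0 \<longleftrightarrow> (\<Sum>n. norm (x n) powr p) = 0"
    by (simp add: lp_norm_def)
  also have "\<dots> \<longleftrightarrow> (\<forall>n. norm (x n) powr p = 0)"
    using s by (intro suminf_eq_zero_iff) auto
  finally show ?thesis
    by (simp add: fun_eq_iff)
qed

text \<open>The convexity estimate behind Minkowski's inequality.\<close>

lemma lp_add_pointwise:
  fixes u v :: complex
  assumes p: "1 < p" and A: "0 < \<alpha>" and B: "0 < \<beta>"
  shows "norm (u + v) powr p
         \<le> (\<alpha> + \<beta>) powr (p - 1) * (\<alpha> powr (1 - p) * norm u powr p + \<beta> powr (1 - p) * norm v powr p)"
proof -
  define t where "t = \<beta> / (\<alpha> + \<beta>)"
  define S where "S = \<alpha> + \<beta>"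
  have S: "0 < S"
    using A B by (simp add: S_def)
  have t: "0 \<le> t" "t \<le> 1" "1 - t = \<alpha> / (\<alpha> + \<beta>)"
    using A B by (auto simp: t_def field_simps)
  have "convex_on {0<..} (\<lambda>x. x powr p)"
    using p by (intro powr_convex) auto
  have cx: "((1 - t) * x + t * y) powr p \<le> (1 - t) * x powr p + t * y powr p"
    if "0 \<le> x" "0 \<le> y" for x y :: real
  proof (cases "x = 0 \<or> y = 0")
    case True
    have scaled: "(q * w) powr p \<le> q * w powr p" if "0 \<le> q" "q \<le> 1" "0 \<le> w" for q w :: real
    proof -
      have "q powr p \<le> q"
        using powr_mono'[of 1 p q] that p by (cases "q = 0") auto
      then show ?thesis
        using that by (simp add: powr_mult mult_right_mono)
    qed
    show ?thesis
      using True that t(1,2) scaled[of t y] scaled[of "1 - t" x] by auto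
  next
    case False
    then show ?thesis
      using convex_onD[OF \<open>convex_on {0<..} (\<lambda>x. x powr p)\<close>, of t x y] t that by auto
  qed
  have "norm (u + v) powr p \<le> (norm u + norm v) powr p"
    using p by (intro powr_mono2 norm_triangle_ineq) auto
  also have "norm u + norm v
      = (\<alpha> + \<beta>) * ((1 - t) * (norm u / \<alpha>) + t * (norm v / \<beta>))"
    unfolding t(3) unfolding t_def S_def[symmetric] using A B S by (simp add: field_simps)
  also have "\<dots> powr p
      = (\<alpha> + \<beta>) powr p * ((1 - t) * (norm u / \<alpha>) + t * (norm v / \<beta>)) powr p"
    by (rule powr_mult)
  also have "\<dots> \<le> (\<alpha> + \<beta>) powr p * ((1 - t) * (norm u / \<alpha>) powr p + t * (norm v / \<beta>) powr p)"
    using A B by (intro mult_left_mono cx) auto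
  also have "\<dots> = (\<alpha> + \<beta>) powr (p - 1)
      * (\<alpha> powr (1 - p) * norm u powr p + \<beta> powr (1 - p) * norm v powr p)"
    unfolding t(3) unfolding t_def S_def[symmetric] using A B S
    by (simp add: powr_divide powr_diff field_simps)
  finally show ?thesis .
qed

lemma lp_add_summable:
  assumes "1 < p" "x \<in> lp p" "y \<in> lp p"
  shows "x + y \<in> lp p"
proof -
  have "summable (\<lambda>n. norm (x n + y n) powr p)"
  proof (rule summable_comparison_test'[where N = 0])
    show "summable (\<lambda>n. (1 + 1) powr (p - 1)
        * (1 powr (1 - p) * norm (x n) powr p + 1 powr (1 - p) * norm (y n) powr p))"
      using assms by (intro summable_mult summable_add) (auto simp: lp_def)
    show "norm (norm (x n + y n) powr p) \<le> (1 + 1) powr (p - 1)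
        * (1 powr (1 - p) * norm (x n) powr p + 1 powr (1 - p) * norm (y n) powr p)" for n
      using lp_add_pointwise[OF assms(1), of 1 1 "x n" "y n"] by simp
  qed
  then show ?thesis
    using assms by (simp add: lp_def)
qed

lemma lp_subspace: "1 < p \<Longrightarrow> seq.subspace (lp p)"
  by (simp add: seq.subspace_def lp_zero lp_add_summable lp_scale)

lemma lp_diff: "1 < p \<Longrightarrow> x \<in> lp p \<Longrightarrow> y \<in> lp p \<Longrightarrow> x - y \<in> lp p"
  by (rule seq.subspace_diff[OF lp_subspace])

lemma lp_norm_triangle:
  assumes p: "1 < p" and x: "x \<in> lp p" and y: "y \<in> lp p"
  shows "lp_norm p (x + y) \<le> lp_norm p x + lp_norm p y"
proof (cases "x = 0 \<or> y = 0")
  case True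
  have "0 \<le> lp_norm p z" for z
    by (simp add: lp_norm_def)
  then show ?thesis
    using True by auto
next
  case False
  define \<alpha> where "\<alpha> = lp_norm p x"
  define \<beta> where "\<beta> = lp_norm p y"
  have pos: "0 < \<alpha>" "0 < \<beta>"
    using lp_norm_zero_iff[OF x] lp_norm_zero_iff[OF y] p False
    by (auto simp: \<alpha>_def \<beta>_def lp_norm_def less_le)
  have sx: "summable (\<lambda>n. norm (x n) powr p)" and sy: "summable (\<lambda>n. norm (y n) powr p)"
    and sxy: "summable (\<lambda>n. norm (x n + y n) powr p)"
    using x y lp_add_summable[OF p x y] by (auto simp: lp_def)
  have norm_powr: "lp_norm p z powr p = (\<Sum>n. norm (z n) powr p)" if "z \<in> lp p" for z
    using that p by (auto simp: lp_norm_def lp_def powr_powr suminf_nonneg)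
  have "(\<Sum>n. norm (x n + y n) powr p) \<le> (\<Sum>n. (\<alpha> + \<beta>) powr (p - 1)
        * (\<alpha> powr (1 - p) * norm (x n) powr p + \<beta> powr (1 - p) * norm (y n) powr p))"
    using sx sy sxy lp_add_pointwise[OF p pos]
    by (intro suminf_le summable_mult summable_add) auto
  also have "\<dots> = (\<alpha> + \<beta>) powr (p - 1)
      * (\<alpha> powr (1 - p) * (\<Sum>n. norm (x n) powr p) + \<beta> powr (1 - p) * (\<Sum>n. norm (y n) powr p))"
    using sx sy by (simp add: suminf_mult suminf_add[symmetric] summable_mult summable_add)
  also have "\<dots> = (\<alpha> + \<beta>) powr (p - 1)
      * (\<alpha> powr (1 - p) * \<alpha> powr p + \<beta> powr (1 - p) * \<beta> powr p)"
    using norm_powr[OF x] norm_powr[OF y] by (simp add: \<alpha>_def \<beta>_def)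
  also have "\<dots> = (\<alpha> + \<beta>) powr (p - 1) * (\<alpha> + \<beta>)"
    using pos by (simp flip: powr_add)
  also have "\<dots> = (\<alpha> + \<beta>) powr p"
    using pos by (simp add: powr_diff)
  finally have "(\<Sum>n. norm (x n + y n) powr p) powr (1 / p) \<le> ((\<alpha> + \<beta>) powr p) powr (1 / p)"
    using p sxy by (intro powr_mono2 suminf_nonneg) auto
  then show ?thesis
    using p pos by (simp add: lp_norm_def powr_powr \<alpha>_def \<beta>_def)
qed

lemma lp_metric_space:
  assumes p: "1 < p"
  shows "Metric_space (lp p) (lp_dist p)"
proof
  show "0 \<le> lp_dist p x y" for x y
    by (simp add: lp_dist_def lp_norm_def)
  show "lp_dist p x y = lp_dist p y x" for x y
    by (simp add: lp_dist_def lp_norm_def norm_minus_commute)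
  show "lp_dist p x y = 0 \<longleftrightarrow> x = y" if "x \<in> lp p" "y \<in> lp p" for x y
    using lp_norm_zero_iff[OF lp_diff[OF p that]] p by (simp add: lp_dist_def)
  show "lp_dist p x z \<le> lp_dist p x y + lp_dist p y z"
    if "x \<in> lp p" "y \<in> lp p" "z \<in> lp p" for x y z
    using lp_norm_triangle[OF p lp_diff[OF p that(1,2)] lp_diff[OF p that(2,3)]]
    by (simp add: lp_dist_def)
qed

text \<open>
  Operators are total functions on sequences; only their values on \<^term>\<open>lp p\<close> matter.
  The set \<open>lp_ops p\<close> is the algebra of bounded linear operators on \<^term>\<open>lp p\<close>.
\<close>

definition lp_ops :: "real \<Rightarrow> ((nat \<Rightarrow> complex) \<Rightarrow> (nat \<Rightarrow> complex)) set" where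
  "lp_ops p = {A. A \<in> lp p \<rightarrow> lp p
     \<and> (\<forall>x\<in>lp p. \<forall>y\<in>lp p. A (x + y) = A x + A y)
     \<and> (\<forall>k. \<forall>x\<in>lp p. A (seq_scale k x) = seq_scale k (A x))
     \<and> (\<exists>K. \<forall>x\<in>lp p. lp_norm p (A x) \<le> K * lp_norm p x)}"

definition shifted :: "((nat \<Rightarrow> complex) \<Rightarrow> (nat \<Rightarrow> complex)) \<Rightarrow> complex
    \<Rightarrow> (nat \<Rightarrow> complex) \<Rightarrow> (nat \<Rightarrow> complex)" where
  "shifted A z = (\<lambda>x. A x - seq_scale z x)"

definition lp_invertible :: "real \<Rightarrow> ((nat \<Rightarrow> complex) \<Rightarrow> (nat \<Rightarrow> complex)) \<Rightarrow> bool" where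
  "lp_invertible p A \<longleftrightarrow> A \<in> lp_ops p \<and>
     (\<exists>B\<in>lp_ops p. \<forall>x\<in>lp p. B (A x) = x \<and> A (B x) = x)"

definition lp_spectrum :: "real \<Rightarrow> ((nat \<Rightarrow> complex) \<Rightarrow> (nat \<Rightarrow> complex)) \<Rightarrow> complex set" where
  "lp_spectrum p A = {z. \<not> lp_invertible p (shifted A z)}"

definition lp_kernel :: "real \<Rightarrow> ((nat \<Rightarrow> complex) \<Rightarrow> (nat \<Rightarrow> complex)) \<Rightarrow> (nat \<Rightarrow> complex) set" where
  "lp_kernel p A = {x \<in> lp p. A x = 0}"

definition lp_range :: "real \<Rightarrow> ((nat \<Rightarrow> complex) \<Rightarrow> (nat \<Rightarrow> complex)) \<Rightarrow> (nat \<Rightarrow> complex) set" where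
  "lp_range p A = A ` lp p"

definition finite_dim :: "(nat \<Rightarrow> complex) set \<Rightarrow> bool" where
  "finite_dim V \<longleftrightarrow> (\<exists>B. finite B \<and> seq.span B = V)"

definition coset_rel :: "(nat \<Rightarrow> complex) set \<Rightarrow> (nat \<Rightarrow> complex) set
    \<Rightarrow> ((nat \<Rightarrow> complex) \<times> (nat \<Rightarrow> complex)) set" where
  "coset_rel V W = {(x, y). x \<in> V \<and> y \<in> V \<and> x - y \<in> W}"

text \<open>
  \<open>V // coset_rel V W\<close> is the quotient space \<open>V / W\<close>, and \<open>seq.span B // coset_rel V W\<close> is the
  image of \<open>seq.span B\<close> under the quotient map, i.e. the span of the cosets of the elements of \<open>B\<close>.
\<close>

definition finite_dim_quotient :: "(nat \<Rightarrow> complex) set \<Rightarrow> (nat \<Rightarrow> complex) set \<Rightarrow> bool" where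
  "finite_dim_quotient V W \<longleftrightarrow>
     (\<exists>B\<subseteq>V. finite B \<and> seq.span B // coset_rel V W = V // coset_rel V W)"

definition lp_fredholm :: "real \<Rightarrow> ((nat \<Rightarrow> complex) \<Rightarrow> (nat \<Rightarrow> complex)) \<Rightarrow> bool" where
  "lp_fredholm p A \<longleftrightarrow> A \<in> lp_ops p
     \<and> closedin (Metric_space.mtopology (lp p) (lp_dist p)) (lp_range p A)
     \<and> finite_dim (lp_kernel p A)
     \<and> finite_dim_quotient (lp p) (lp_range p A)"

definition lp_ess_spectrum :: "real \<Rightarrow> ((nat \<Rightarrow> complex) \<Rightarrow> (nat \<Rightarrow> complex)) \<Rightarrow> complex set" where
  "lp_ess_spectrum p A = {z. \<not> lp_fredholm p (shifted A z)}"

text \<open>The values \<open>a 0\<close>, \<open>b 0\<close> and \<open>c 0\<close> of the coefficient sequences are never used.\<close>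

definition op_T :: "(nat \<Rightarrow> complex) \<Rightarrow> (nat \<Rightarrow> complex) \<Rightarrow> (nat \<Rightarrow> complex)
    \<Rightarrow> (nat \<Rightarrow> complex) \<Rightarrow> (nat \<Rightarrow> complex)" where
  "op_T a b c x = (\<lambda>n. if n = 0 then 0
     else (if n \<le> 2 then 0 else c (n - 2) * x (n - 2)) + a n * x n + b n * x (n + 2))"

definition op_T0 :: "real \<Rightarrow> real \<Rightarrow> real \<Rightarrow> real
    \<Rightarrow> (nat \<Rightarrow> complex) \<Rightarrow> (nat \<Rightarrow> complex)" where
  "op_T0 r1 r2 s1 s2 x = (\<lambda>n. if n = 0 then 0
     else let r = complex_of_real (if odd n then r1 else r2);
              s = complex_of_real (if odd n then s1 else s2)
          in s * (if n \<le> 2 then 0 else x (n - 2)) + r * x n + s * x (n + 2))"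

end

theory Submission
  imports Defs
begin

text \<open>
  Off the two intervals, \<open>op_T0 - \<lambda>\<close> factors on each parity class into two Neumann-invertible
  factors. Splitting the coefficients of \<open>op_T - op_T0\<close> at a large index writes \<open>op_T - \<lambda>\<close> as an
  invertible operator plus one of finite rank, which is Fredholm.

  On the intervals, truncated plane waves form a Weyl sequence with disjoint supports. Summing
  it with growing norms gives formal sequences outside \<open>lp p\<close> whose images are in the closure of
  the range. Since \<open>b\<close> has no zeros, the formal kernel of \<open>op_T - \<lambda>\<close> is one-dimensional on each parity
  class, too small to correct these sequences to elements of \<open>lp p\<close>, so the range is not closed.
  Invertible operators being Fredholm, the same argument applied to \<open>op_T0\<close> gives its spectrum.
\<close>

section \<open>Bounded operators on the sequence spaces\<close>

text \<open>Both operators couple the place n only with n - 2 and n + 2, so each splits into two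
  tridiagonal operators with convergent coefficients, one on the odd and one on the even places. A
  limiting operator with diagonal r and off-diagonals s has the symbol r + s (z + 1 / z). On the
  unit circle this is r + 2 s cos \<theta>, which sweeps out exactly [r - 2 s, r + 2 s]. Hence the
  two cases: a value off the interval is attained at some z with 0 < norm z < 1, which supplies the
  two factors, and a value on it is attained at \<open>cis \<theta>\<close>, which supplies the
  plane waves.

  A Weyl sequence alone only rules out a bounded inverse. The obstacle to more is the kernel: a
  formal series with image in \<open>lp p\<close> might be repaired by a formal kernel vector, and
  then its image would lie in the range after all. Interleaving the humps into two series leaves one
  free kernel parameter in a parity class against two series, so one combination escapes
  repair.\<close>

lemma lp_norm_nonneg [simp]: "0 \<le> lp_norm p x"
  by (simp add: lp_norm_def)

lemma lp_norm_zero [simp]: "lp_norm p 0 = 0"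
  by (simp add: lp_norm_def)

lemma lp_at_0: "x \<in> lp p \<Longrightarrow> x 0 = 0"
  by (simp add: lp_def)

lemma lp_norm_minus_commute: "lp_norm p (x - y) = lp_norm p (y - x)"
  by (simp add: lp_norm_def norm_minus_commute)

context
  fixes p :: real
  assumes p: "1 < p"
begin

section \<open>Norm estimates, and series with summable norms\<close>

lemma lp_norm_powr:
  assumes "x \<in> lp p"
  shows "lp_norm p x powr p = (\<Sum>n. norm (x n) powr p)"
  using assms p by (auto simp: lp_norm_def lp_def powr_powr suminf_nonneg)

lemma sum_le_lp_norm_powr:
  assumes "x \<in> lp p" "finite F"
  shows "(\<Sum>n\<in>F. norm (x n) powr p) \<le> lp_norm p x powr p"
  unfolding lp_norm_powr[OF assms(1)]
  using assms by (intro sum_le_suminf) (auto simp: lp_def)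

text \<open>Uniformly bounded finite sums yield summability and the norm bound together, so later
  estimates only handle finite sums.\<close>

lemma lp_boundI:
  assumes "x 0 = 0" "0 \<le> C" "\<And>N. (\<Sum>n<N. norm (x n) powr p) \<le> C powr p"
  shows "x \<in> lp p" "lp_norm p x \<le> C"
proof -
  have s: "summable (\<lambda>n. norm (x n) powr p)"
    by (rule summableI_nonneg_bounded[where x = "C powr p"]) (use assms in auto)
  then show "x \<in> lp p"
    using assms by (simp add: lp_def)
  have "(\<Sum>n. norm (x n) powr p) \<le> C powr p"
    by (rule suminf_le_const[OF s assms(3)])
  then have "lp_norm p x \<le> (C powr p) powr (1 / p)"
    unfolding lp_norm_def using p s by (intro powr_mono2 suminf_nonneg) auto
  then show "lp_norm p x \<le> C"
    using p assms by (simp add: powr_powr)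
qed

lemma norm_le_lp_norm:
  assumes "x \<in> lp p"
  shows "norm (x n) \<le> lp_norm p x"
proof -
  have "norm (x n) powr p \<le> lp_norm p x powr p"
    using sum_le_lp_norm_powr[OF assms, of "{n}"] by simp
  then show ?thesis
    using p powr_less_mono2[of p "lp_norm p x" "norm (x n)"] by force
qed

text \<open>Since \<open>f\<close> is injective on \<open>S\<close>, each entry of \<open>x\<close>
  is charged at most once. Shifts, truncations and multiplication by bounded sequences are all
  instances.\<close>

lemma lp_reindex:
  assumes x: "x \<in> lp p" and C: "0 \<le> C" and y0: "y 0 = 0" and f: "inj_on f S"
    and out: "\<And>n. n \<notin> S \<Longrightarrow> y n = 0"
    and dom: "\<And>n. n \<in> S \<Longrightarrow> norm (y n) \<le> C * norm (x (f n))"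
  shows "y \<in> lp p" "lp_norm p y \<le> C * lp_norm p x"
proof -
  have "(\<Sum>n<N. norm (y n) powr p) \<le> (C * lp_norm p x) powr p" for N
  proof -
    have "(\<Sum>n<N. norm (y n) powr p) = (\<Sum>n\<in>S \<inter> {..<N}. norm (y n) powr p)"
      using out by (intro sum.mono_neutral_right) auto
    also have "\<dots> \<le> (\<Sum>n\<in>S \<inter> {..<N}. C powr p * norm (x (f n)) powr p)"
      using dom p C by (intro sum_mono) (auto simp flip: powr_mult intro!: powr_mono2)
    also have "\<dots> = C powr p * (\<Sum>m\<in>f ` (S \<inter> {..<N}). norm (x m) powr p)"
      using f by (subst sum.reindex) (auto simp: sum_distrib_left inj_on_def)
    also have "\<dots> \<le> C powr p * lp_norm p x powr p"
      by (intro mult_left_mono sum_le_lp_norm_powr x) auto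
    finally show ?thesis
      by (simp add: powr_mult)
  qed
  from lp_boundI[OF y0 _ this] show "y \<in> lp p" "lp_norm p y \<le> C * lp_norm p x"
    using C by simp_all
qed

lemma lp_finite_support:
  assumes "finite S" "0 \<notin> S" "0 \<le> C" "\<And>n. n \<notin> S \<Longrightarrow> x n = 0" "\<And>n. norm (x n) \<le> C"
  shows "x \<in> lp p" "lp_norm p x \<le> real (card S) powr (1 / p) * C"
proof -
  have "(\<Sum>n<N. norm (x n) powr p) \<le> (real (card S) powr (1 / p) * C) powr p" for N
  proof -
    have "(\<Sum>n<N. norm (x n) powr p) = (\<Sum>n\<in>S \<inter> {..<N}. norm (x n) powr p)"
      using assms(4) by (intro sum.mono_neutral_right) auto
    also have "\<dots> \<le> (\<Sum>n\<in>S. norm (x n) powr p)"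
      using assms by (intro sum_mono2) auto
    also have "\<dots> \<le> (\<Sum>n\<in>S. C powr p)"
      using assms p by (intro sum_mono powr_mono2) auto
    finally show ?thesis
      using p by (simp add: powr_mult powr_powr)
  qed
  from lp_boundI[OF _ _ this]
  show "x \<in> lp p" "lp_norm p x \<le> real (card S) powr (1 / p) * C"
    using assms by simp_all
qed

lemma lp_add: "x \<in> lp p \<Longrightarrow> y \<in> lp p \<Longrightarrow> x + y \<in> lp p"
  by (rule lp_add_summable[OF p])

lemma lp_norm_scale_le:
  assumes "x \<in> lp p"
  shows "lp_norm p (seq_scale k x) \<le> norm k * lp_norm p x"
  by (rule lp_reindex(2)[OF assms, where f = "\<lambda>n. n" and S = UNIV])
    (use lp_at_0[OF assms] in \<open>auto simp: seq_scale_def norm_mult\<close>)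

lemma lp_sum:
  fixes x :: "nat \<Rightarrow> nat \<Rightarrow> complex"
  assumes "\<And>k. x k \<in> lp p"
  shows "(\<lambda>n. \<Sum>k<m. x k n) \<in> lp p"
    and "lp_norm p (\<lambda>n. \<Sum>k<m. x k n) \<le> (\<Sum>k<m. lp_norm p (x k))"
proof (induction m)
  case (Suc m)
  have *: "(\<lambda>n. \<Sum>k<Suc m. x k n) = (\<lambda>n. \<Sum>k<m. x k n) + x m"
    by (simp add: fun_eq_iff)
  case 1
  show ?case
    unfolding * using Suc(1) assms by (intro lp_add) auto
  case 2
  show ?case
    unfolding * using lp_norm_triangle[OF p Suc(1) assms[of m]] Suc(2) by simp
qed (use lp_zero in \<open>simp_all flip: zero_fun_def\<close>)

text \<open>Completeness of \<open>lp p\<close> in the form in which it is used, with the sum taken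
  entry by entry. The triangle inequality for the first m terms bounds every finite sum over n, and
  this bound survives the limit in m.\<close>

lemma lp_series_bound:
  assumes x: "\<And>k. x k \<in> lp p" and s: "summable (\<lambda>k. lp_norm p (x k))"
  shows "summable (\<lambda>k. x k n)" "(\<lambda>n. \<Sum>k. x k n) \<in> lp p"
    "lp_norm p (\<lambda>n. \<Sum>k. x k n) \<le> (\<Sum>k. lp_norm p (x k))"
proof -
  show sn: "summable (\<lambda>k. x k n)" for n
    by (rule summable_comparison_test'[OF s, of 0]) (use norm_le_lp_norm[OF x] in auto)
  have "(\<Sum>n<N. norm (\<Sum>k. x k n) powr p) \<le> (\<Sum>k. lp_norm p (x k)) powr p" for N
  proof (rule LIMSEQ_le_const2)
    show "(\<lambda>m. \<Sum>n<N. norm (\<Sum>k<m. x k n) powr p) \<longlonglongrightarrow> (\<Sum>n<N. norm (\<Sum>k. x k n) powr p)"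
      using p by (intro tendsto_sum tendsto_powr' tendsto_norm summable_LIMSEQ sn tendsto_const)
        auto
    have "(\<Sum>n<N. norm (\<Sum>k<m. x k n) powr p) \<le> (\<Sum>k. lp_norm p (x k)) powr p" for m
    proof -
      have "(\<Sum>n<N. norm (\<Sum>k<m. x k n) powr p) \<le> lp_norm p (\<lambda>n. \<Sum>k<m. x k n) powr p"
        by (rule sum_le_lp_norm_powr[OF lp_sum(1)[OF x]]) simp
      also have "\<dots> \<le> (\<Sum>k. lp_norm p (x k)) powr p"
        using p order_trans[OF lp_sum(2)[OF x] sum_le_suminf[OF s]]
        by (intro powr_mono2) auto
      finally show ?thesis .
    qed
    then show "\<exists>M. \<forall>m\<ge>M. (\<Sum>n<N. norm (\<Sum>k<m. x k n) powr p) \<le> (\<Sum>k. lp_norm p (x k)) powr p"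
      by blast
  qed
  from lp_boundI[OF _ _ this] show "(\<lambda>n. \<Sum>k. x k n) \<in> lp p"
    "lp_norm p (\<lambda>n. \<Sum>k. x k n) \<le> (\<Sum>k. lp_norm p (x k))"
    using lp_at_0[OF x] s by (simp_all add: suminf_nonneg)
qed

lemma lp_series_tendsto:
  assumes x: "\<And>k. x k \<in> lp p" and s: "summable (\<lambda>k. lp_norm p (x k))"
  shows "(\<lambda>m. lp_norm p ((\<lambda>n. \<Sum>k<m. x k n) - (\<lambda>n. \<Sum>k. x k n))) \<longlonglongrightarrow> 0"
proof (rule tendsto_sandwich[OF _ _ tendsto_const])
  show "(\<lambda>m. \<Sum>k. lp_norm p (x (k + m))) \<longlonglongrightarrow> 0"
    using suminf_exist_split2[OF s] .
  have "lp_norm p ((\<lambda>n. \<Sum>k<m. x k n) - (\<lambda>n. \<Sum>k. x k n)) \<le> (\<Sum>k. lp_norm p (x (k + m)))" for m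
  proof -
    have "(\<lambda>n. \<Sum>k. x k n) - (\<lambda>n. \<Sum>k<m. x k n) = (\<lambda>n. \<Sum>k. x (k + m) n)"
      using suminf_minus_initial_segment[OF lp_series_bound(1)[OF x s]] by (simp add: fun_eq_iff)
    then show ?thesis
      using lp_series_bound(3)[of "\<lambda>k. x (k + m)"] x summable_ignore_initial_segment[OF s, of m]
      by (subst lp_norm_minus_commute) simp
  qed
  then show "\<forall>\<^sub>F m in sequentially. lp_norm p ((\<lambda>n. \<Sum>k<m. x k n) - (\<lambda>n. \<Sum>k. x k n))
      \<le> (\<Sum>k. lp_norm p (x (k + m)))"
    by simp
qed auto

lemma lp_tendsto_pointwise:
  assumes "\<And>m. f m \<in> lp p" "y \<in> lp p" "(\<lambda>m. lp_norm p (f m - y)) \<longlonglongrightarrow> 0"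
  shows "(\<lambda>m. f m n) \<longlonglongrightarrow> y n"
proof -
  have "(\<lambda>m. f m n - y n) \<longlonglongrightarrow> 0"
    by (rule Lim_null_comparison[OF _ assms(3)])
      (use norm_le_lp_norm[OF lp_diff[OF p assms(1,2)], of _ n] in auto)
  then show ?thesis
    by (simp add: LIM_zero_iff)
qed

text \<open>The topology enters the later arguments only through this sequential criterion.\<close>

lemma lp_closedin_iff:
  "closedin (Metric_space.mtopology (lp p) (lp_dist p)) S \<longleftrightarrow>
     S \<subseteq> lp p \<and> (\<forall>f y. (\<forall>m. f m \<in> S) \<and> y \<in> lp p \<and> (\<lambda>m. lp_norm p (f m - y)) \<longlonglongrightarrow> 0 \<longrightarrow> y \<in> S)"
proof -
  interpret Metric_space "lp p" "lp_dist p"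
    by (rule lp_metric_space[OF p])
  show ?thesis
    unfolding metric_closedin_iff_sequentially_closed limitin_metric_dist_null lp_dist_def
      image_subset_iff
    by (rule conj_cong[OF refl], intro iff_allI) (auto intro!: always_eventually)
qed

section \<open>Algebra of bounded operators and Neumann inversion\<close>

lemma lp_opsI:
  assumes "\<And>x. x \<in> lp p \<Longrightarrow> A x \<in> lp p" "\<And>x y. x \<in> lp p \<Longrightarrow> y \<in> lp p \<Longrightarrow> A (x + y) = A x + A y"
    "\<And>k x. x \<in> lp p \<Longrightarrow> A (seq_scale k x) = seq_scale k (A x)"
    "\<And>x. x \<in> lp p \<Longrightarrow> lp_norm p (A x) \<le> K * lp_norm p x"
  shows "A \<in> lp_ops p"
  using assms unfolding lp_ops_def by blast

lemma lp_opsD: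
  assumes "A \<in> lp_ops p"
  shows "x \<in> lp p \<Longrightarrow> A x \<in> lp p" "x \<in> lp p \<Longrightarrow> y \<in> lp p \<Longrightarrow> A (x + y) = A x + A y"
    "x \<in> lp p \<Longrightarrow> A (seq_scale k x) = seq_scale k (A x)"
    "x \<in> lp p \<Longrightarrow> y \<in> lp p \<Longrightarrow> A (x - y) = A x - A y" "A 0 = 0"
proof -
  show 1: "x \<in> lp p \<Longrightarrow> A x \<in> lp p" "x \<in> lp p \<Longrightarrow> y \<in> lp p \<Longrightarrow> A (x + y) = A x + A y"
    "x \<in> lp p \<Longrightarrow> A (seq_scale k x) = seq_scale k (A x)" for x y k
    using assms by (auto simp: lp_ops_def)
  show "x \<in> lp p \<Longrightarrow> y \<in> lp p \<Longrightarrow> A (x - y) = A x - A y"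
    using 1(2)[of "x - y" y] lp_diff[OF p] by auto
  show "A 0 = 0"
    using 1(2)[OF lp_zero lp_zero] by simp
qed

lemma lp_ops_bound:
  assumes "A \<in> lp_ops p"
  obtains K where "0 < K" "\<And>x. x \<in> lp p \<Longrightarrow> lp_norm p (A x) \<le> K * lp_norm p x"
proof -
  obtain K where K: "\<forall>x\<in>lp p. lp_norm p (A x) \<le> K * lp_norm p x"
    using assms by (auto simp: lp_ops_def)
  have "lp_norm p (A x) \<le> (\<bar>K\<bar> + 1) * lp_norm p x" if "x \<in> lp p" for x
  proof -
    have "K * lp_norm p x \<le> (\<bar>K\<bar> + 1) * lp_norm p x"
      by (intro mult_right_mono) auto
    then show ?thesis
      using K that by force
  qed
  then show thesis
    by (intro that[of "\<bar>K\<bar> + 1"]) auto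
qed

lemma lp_ops_compose:
  assumes A: "A \<in> lp_ops p" and B: "B \<in> lp_ops p"
  shows "(\<lambda>x. A (B x)) \<in> lp_ops p"
proof -
  obtain K where K: "0 < K" "\<And>x. x \<in> lp p \<Longrightarrow> lp_norm p (A x) \<le> K * lp_norm p x"
    using lp_ops_bound[OF A] by blast
  obtain K' where K': "0 < K'" "\<And>x. x \<in> lp p \<Longrightarrow> lp_norm p (B x) \<le> K' * lp_norm p x"
    using lp_ops_bound[OF B] by blast
  show ?thesis
  proof (rule lp_opsI)
    show "lp_norm p (A (B x)) \<le> (K * K') * lp_norm p x" if "x \<in> lp p" for x
      using K(2)[OF lp_opsD(1)[OF B that]] mult_left_mono[OF K'(2)[OF that], of K] K(1)
      by (simp add: mult.assoc order_trans)
  qed (simp_all add: lp_opsD[OF A] lp_opsD[OF B])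
qed

lemma lp_ops_add:
  assumes A: "A \<in> lp_ops p" and B: "B \<in> lp_ops p"
  shows "(\<lambda>x. A x + B x) \<in> lp_ops p"
proof -
  obtain K where K: "0 < K" "\<And>x. x \<in> lp p \<Longrightarrow> lp_norm p (A x) \<le> K * lp_norm p x"
    using lp_ops_bound[OF A] by blast
  obtain K' where K': "0 < K'" "\<And>x. x \<in> lp p \<Longrightarrow> lp_norm p (B x) \<le> K' * lp_norm p x"
    using lp_ops_bound[OF B] by blast
  show ?thesis
  proof (rule lp_opsI)
    show "lp_norm p (A x + B x) \<le> (K + K') * lp_norm p x" if "x \<in> lp p" for x
      using lp_norm_triangle[OF p lp_opsD(1)[OF A that] lp_opsD(1)[OF B that]] K(2) K'(2) that
      by (force simp: distrib_right)
  qed (simp_all add: lp_opsD[OF A] lp_opsD[OF B] lp_add seq.scale_right_distrib)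
qed

lemma lp_ops_id: "(\<lambda>x. x) \<in> lp_ops p"
  by (rule lp_opsI[where K = 1]) auto

lemma lp_ops_scale:
  assumes A: "A \<in> lp_ops p"
  shows "(\<lambda>x. seq_scale k (A x)) \<in> lp_ops p"
proof -
  have "seq_scale k \<in> lp_ops p"
    by (rule lp_opsI[where K = "norm k"])
      (auto simp: lp_scale seq.scale_right_distrib seq.scale_left_commute lp_norm_scale_le)
  from lp_ops_compose[OF this A] show ?thesis
    by simp
qed

lemma lp_ops_diff:
  assumes A: "A \<in> lp_ops p" and B: "B \<in> lp_ops p"
  shows "(\<lambda>x. A x - B x) \<in> lp_ops p"
  using lp_ops_add[OF A lp_ops_scale[OF B, of "-1"]] by (simp add: seq.scale_minus_left)

text \<open>Operators are total functions, and identities such as \<open>shifted_op_T\<close> hold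
  only where \<open>x 0 = 0\<close>. Boundedness, invertibility and the Fredholm property therefore
  have to be seen to depend on the values on \<open>lp p\<close> alone.\<close>

lemma lp_ops_cong:
  assumes "\<And>x. x \<in> lp p \<Longrightarrow> A x = B x"
  shows "A \<in> lp_ops p \<longleftrightarrow> B \<in> lp_ops p"
proof -
  have "A \<in> lp_ops p" if eq: "\<And>x. x \<in> lp p \<Longrightarrow> A x = B x" and B: "B \<in> lp_ops p" for A B
  proof -
    obtain K where "\<And>x. x \<in> lp p \<Longrightarrow> lp_norm p (B x) \<le> K * lp_norm p x"
      using lp_ops_bound[OF B] by blast
    then show ?thesis
      by (intro lp_opsI[where K = K]) (simp_all add: eq lp_opsD[OF B] lp_add lp_scale)
  qed
  from this[of A B] this[of B A] show ?thesis
    using assms by auto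
qed

lemma lp_invertible_cong:
  assumes "\<And>x. x \<in> lp p \<Longrightarrow> A x = B x"
  shows "lp_invertible p A \<longleftrightarrow> lp_invertible p B"
proof -
  have "lp_invertible p A" if eq: "\<And>x. x \<in> lp p \<Longrightarrow> A x = B x" and B: "lp_invertible p B" for A B
    proof -
    obtain C where "B \<in> lp_ops p" "C \<in> lp_ops p" "\<forall>x\<in>lp p. C (B x) = x \<and> B (C x) = x"
      using B by (auto simp: lp_invertible_def)
    moreover from this have "A \<in> lp_ops p"
      using lp_ops_cong[of A B] eq by simp
    ultimately show ?thesis
      unfolding lp_invertible_def by (auto simp: eq lp_opsD(1) intro!: bexI[of _ C])
  qed
  from this[of A B] this[of B A] show ?thesis
    using assms by auto
qed

lemma lp_fredholm_cong:
  assumes "\<And>x. x \<in> lp p \<Longrightarrow> A x = B x"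
  shows "lp_fredholm p A \<longleftrightarrow> lp_fredholm p B"
proof -
  have "lp_range p A = lp_range p B" "lp_kernel p A = lp_kernel p B"
    using assms by (auto simp: lp_range_def lp_kernel_def)
  then show ?thesis
    by (simp add: lp_fredholm_def lp_ops_cong[OF assms])
qed

text \<open>The lower bound does two things: it makes \<open>A\<close> injective, and it bounds the
  inverse by \<open>1 / c\<close>.\<close>

lemma lp_invertibleI:
  assumes A: "A \<in> lp_ops p" and c: "0 < c" "\<And>x. x \<in> lp p \<Longrightarrow> c * lp_norm p x \<le> lp_norm p (A x)"
    and surj: "\<And>y. y \<in> lp p \<Longrightarrow> \<exists>x\<in>lp p. A x = y"
  shows "lp_invertible p A"
proof -
  have inj: "x = y" if "x \<in> lp p" "y \<in> lp p" "A x = A y" for x y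
  proof -
    have "c * lp_norm p (x - y) \<le> 0"
      using c(2)[OF lp_diff[OF p that(1,2)]] that by (simp add: lp_opsD(4)[OF A])
    then have "lp_norm p (x - y) = 0"
      using c(1) by (simp add: mult_le_0_iff order_antisym)
    then show ?thesis
      using lp_norm_zero_iff[OF lp_diff[OF p that(1,2)]] p by simp
  qed
  obtain B where B: "\<And>y. y \<in> lp p \<Longrightarrow> B y \<in> lp p" "\<And>y. y \<in> lp p \<Longrightarrow> A (B y) = y"
    using surj by metis
  have "B \<in> lp_ops p"
  proof (rule lp_opsI[where K = "1 / c"])
    show "B (x + y) = B x + B y" if "x \<in> lp p" "y \<in> lp p" for x y
      using that by - (rule inj, auto simp: lp_opsD[OF A] B lp_add)
    show "B (seq_scale k x) = seq_scale k (B x)" if "x \<in> lp p" for x k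
      using that by - (rule inj, auto simp: lp_opsD[OF A] B lp_scale)
    show "lp_norm p (B x) \<le> 1 / c * lp_norm p x" if "x \<in> lp p" for x
      using c(2)[OF B(1)[OF that]] c(1) that by (simp add: B field_simps)
  qed (rule B)
  moreover have "B (A x) = x \<and> A (B x) = x" if "x \<in> lp p" for x
    using inj[of "B (A x)" x] that by (simp add: lp_opsD(1)[OF A] B)
  ultimately show ?thesis
    using A by (auto simp: lp_invertible_def)
qed

lemma lp_invertible_compose:
  assumes "lp_invertible p A" "lp_invertible p B"
  shows "lp_invertible p (\<lambda>x. A (B x))"
proof -
  from assms obtain A' B' where A: "A \<in> lp_ops p" "A' \<in> lp_ops p" "\<forall>x\<in>lp p. A' (A x) = x \<and> A (A' x) = x"
    and B: "B \<in> lp_ops p" "B' \<in> lp_ops p" "\<forall>x\<in>lp p. B' (B x) = x \<and> B (B' x) = x"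
    by (auto simp: lp_invertible_def)
  have "\<forall>x\<in>lp p. B' (A' (A (B x))) = x \<and> A (B (B' (A' x))) = x"
    using A B by (simp add: lp_opsD(1))
  then show ?thesis
    unfolding lp_invertible_def
    using lp_ops_compose[OF A(1) B(1)] lp_ops_compose[OF B(2) A(2)]
    by (intro conjI bexI[of _ "\<lambda>x. B' (A' x)"])
qed

lemma lp_ops_sum:
  fixes x :: "nat \<Rightarrow> nat \<Rightarrow> complex"
  assumes A: "A \<in> lp_ops p" and x: "\<And>k. x k \<in> lp p"
  shows "A (\<lambda>n. \<Sum>k<m. x k n) = (\<lambda>n. \<Sum>k<m. A (x k) n)"
proof (induction m)
  case 0
  show ?case
    using lp_opsD(5)[OF A] by (simp add: zero_fun_def)
next
  case (Suc m)
  have "(\<lambda>n. \<Sum>k<Suc m. x k n) = (\<lambda>n. \<Sum>k<m. x k n) + x m"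
    by (simp add: fun_eq_iff)
  then show ?case
    using Suc by (simp only: lp_opsD(2)[OF A lp_sum(1)[OF x] x]) (simp add: fun_eq_iff)
qed

lemma lp_neumann:
  assumes A: "A \<in> lp_ops p" and q: "q < 1" "\<And>x. x \<in> lp p \<Longrightarrow> lp_norm p (A x) \<le> q * lp_norm p x"
  shows "lp_invertible p (\<lambda>x. x - A x)"
proof (rule lp_invertibleI[where c = "1 - q"])
  show "(\<lambda>x. x - A x) \<in> lp_ops p"
    by (rule lp_ops_diff[OF lp_ops_id A])
  show "(1 - q) * lp_norm p x \<le> lp_norm p (x - A x)" if x: "x \<in> lp p" for x
    using lp_norm_triangle[OF p lp_diff[OF p x] lp_opsD(1)[OF A x], of "A x"]
      q(2)[OF x] lp_opsD(1)[OF A x]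
    by (simp add: algebra_simps)
  show "\<exists>x\<in>lp p. x - A x = y" if y: "y \<in> lp p" for y
  proof -
    \<comment> \<open>Only \<open>q < 1\<close> is assumed, while the geometric estimate multiplies
      by the ratio and so wants it nonnegative.\<close>
    define r where "r = max q 0"
    have r: "0 \<le> r" "r < 1" "\<And>x. x \<in> lp p \<Longrightarrow> lp_norm p (A x) \<le> r * lp_norm p x"
      using q order_trans[OF q(2) mult_right_mono[of q r]] by (auto simp: r_def)
    define X where "X k = (A ^^ k) y" for k
    have X: "X k \<in> lp p" for k
      by (induction k) (auto simp: X_def y lp_opsD(1)[OF A])
    have AX: "A (X k) = X (Suc k)" for k
      by (simp add: X_def)
    have bound: "lp_norm p (X k) \<le> r ^ k * lp_norm p y" for k
    proof (induction k)
      case (Suc k)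
      then show ?case
        using r(3)[OF X[of k]] mult_left_mono[OF Suc r(1)] by (simp add: AX mult.assoc)
    qed (simp add: X_def)
    have s: "summable (\<lambda>k. lp_norm p (X k))"
      by (rule summable_comparison_test'[where N = 0 and g = "\<lambda>k. r ^ k * lp_norm p y"])
        (use r bound in \<open>auto intro!: summable_mult2 summable_geometric\<close>)
    define x where "x = (\<lambda>n. \<Sum>k. X k n)"
    define S where "S m = (\<lambda>n. \<Sum>k<m. X k n)" for m
    have x: "x \<in> lp p"
      unfolding x_def by (rule lp_series_bound[OF X s])
    have S: "S m \<in> lp p" for m
      unfolding S_def by (rule lp_sum[OF X])
    have lim: "(\<lambda>m. lp_norm p (S m - x)) \<longlonglongrightarrow> 0"
      unfolding x_def S_def by (rule lp_series_tendsto[OF X s])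
    have "(\<lambda>m. lp_norm p (A (S m) - A x)) \<longlonglongrightarrow> 0"
    proof (rule tendsto_sandwich[OF _ _ tendsto_const tendsto_mult_right_zero[OF lim]])
      show "\<forall>\<^sub>F m in sequentially. lp_norm p (A (S m) - A x) \<le> r * lp_norm p (S m - x)"
        using r(3)[OF lp_diff[OF p S x]] by (simp add: lp_opsD(4)[OF A S x])
    qed auto
    then have 1: "(\<lambda>m. A (S m) n) \<longlonglongrightarrow> A x n" for n
      by (intro lp_tendsto_pointwise lp_opsD(1)[OF A] S x)
    \<comment> \<open>Applying \<open>A\<close> advances the partial sums of the Neumann series by
      one term. Both sides converge in each coordinate, which gives
      \<open>A x = x - y\<close>.\<close>
    have "A (S m) n = S (Suc m) n - y n" for m n
      unfolding S_def lp_ops_sum[OF A X] AX by (subst sum.lessThan_Suc_shift) (simp add: X_def)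
    moreover have "(\<lambda>m. S (Suc m) n - y n) \<longlonglongrightarrow> x n - y n" for n
      by (intro tendsto_intros LIMSEQ_Suc lp_tendsto_pointwise[OF S x lim])
    ultimately have "A x n = x n - y n" for n
      using LIMSEQ_unique[OF 1[of n]] by simp
    then show ?thesis
      using x by (intro bexI[of _ x]) (auto simp: fun_eq_iff)
  qed
qed (use q in auto)

text \<open>If \<open>B\<close> inverts \<open>A\<close> and has bound \<open>C\<close>, then A + K
  = A (I + B K), and \<delta> = 1 / (2 C) makes the norm of B K at most 1/2. As \<delta> depends on
  \<open>A\<close> alone, it can be fixed before deciding where to cut the coefficients of a
  perturbation.\<close>

lemma lp_invertible_perturb:
  assumes A: "lp_invertible p A"
  obtains \<delta> where "0 < \<delta>" "\<And>K. K \<in> lp_ops p \<Longrightarrow>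
    (\<And>x. x \<in> lp p \<Longrightarrow> lp_norm p (K x) \<le> \<delta> * lp_norm p x) \<Longrightarrow> lp_invertible p (\<lambda>x. A x + K x)"
proof -
  from A obtain B where A': "A \<in> lp_ops p" and B: "B \<in> lp_ops p" "\<forall>x\<in>lp p. B (A x) = x \<and> A (B x) = x"
    by (auto simp: lp_invertible_def)
  obtain C where C: "0 < C" "\<And>x. x \<in> lp p \<Longrightarrow> lp_norm p (B x) \<le> C * lp_norm p x"
    using lp_ops_bound[OF B(1)] by blast
  show thesis
  proof (rule that[of "1 / (2 * C)"])
    show "0 < 1 / (2 * C)"
      using C by simp
    fix K
    assume K: "K \<in> lp_ops p" and small: "\<And>x. x \<in> lp p \<Longrightarrow> lp_norm p (K x) \<le> 1 / (2 * C) * lp_norm p x"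
    define G where "G x = seq_scale (-1) (B (K x))" for x
    have G: "G \<in> lp_ops p"
      using lp_ops_scale[OF lp_ops_compose[OF B(1) K], of "-1"] by (simp add: G_def[abs_def])
    have "lp_norm p (G x) \<le> 1 / 2 * lp_norm p x" if "x \<in> lp p" for x
    proof -
      have "lp_norm p (G x) \<le> lp_norm p (B (K x))"
        using lp_norm_scale_le[of "B (K x)" "-1"] that K B by (simp add: G_def lp_opsD(1))
      also have "\<dots> \<le> C * (1 / (2 * C) * lp_norm p x)"
        using C(2)[OF lp_opsD(1)[OF K that]] mult_left_mono[OF small[OF that], of C] C(1) by simp
      finally show ?thesis
        using C(1) by simp
    qed
    then have "lp_invertible p (\<lambda>x. A (x - G x))"
      by (intro lp_invertible_compose[OF A] lp_neumann[OF G, of "1 / 2"]) auto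
    moreover have "A (x - G x) = A x + K x" if x: "x \<in> lp p" for x
    proof -
      have "A (x - G x) = A (x + B (K x))"
        by (simp add: G_def seq.scale_minus_left)
      also have "\<dots> = A x + K x"
        using x B K A' by (simp add: lp_opsD(1,2)[of A] lp_opsD(1)[of B] lp_opsD(1)[of K] del: plus_fun_apply)
      finally show ?thesis .
    qed
    ultimately show "lp_invertible p (\<lambda>x. A x + K x)"
      using lp_invertible_cong[of "\<lambda>x. A (x - G x)"] by simp
  qed
qed

end

section \<open>Finite-rank perturbations of invertible operators\<close>

lemma lp_ops_span:
  assumes p: "1 < p" and A: "A \<in> lp_ops p" and E: "E \<subseteq> lp p" and x: "x \<in> seq.span E"
  shows "A x \<in> seq.span (A ` E)"
proof -
  have "seq.span E \<subseteq> {x \<in> lp p. A x \<in> seq.span (A ` E)}"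
  proof (rule seq.span_minimal)
    show "E \<subseteq> {x \<in> lp p. A x \<in> seq.span (A ` E)}"
      using E by (auto intro: seq.span_base)
    show "seq.subspace {x \<in> lp p. A x \<in> seq.span (A ` E)}"
      by (rule seq.subspaceI)
        (auto simp: lp_zero lp_add[OF p] lp_scale lp_opsD[OF p A] seq.span_zero
          intro: seq.span_add seq.span_scale)
  qed
  then show ?thesis
    using x by blast
qed

lemma lp_ops_subspace_image:
  assumes p: "1 < p" and A: "A \<in> lp_ops p" and V: "seq.subspace V" "V \<subseteq> lp p"
  shows "seq.subspace (A ` V)"
proof (rule seq.subspaceI)
  show "0 \<in> A ` V"
    using lp_opsD(5)[OF p A] seq.subspace_0[OF V(1)] by (metis imageI)
  show "x + y \<in> A ` V" if "x \<in> A ` V" "y \<in> A ` V" for x y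
  proof -
    obtain u v where "u \<in> V" "v \<in> V" "x = A u" "y = A v"
      using \<open>x \<in> A ` V\<close> \<open>y \<in> A ` V\<close> by blast
    then have "x + y = A (u + v)" "u + v \<in> V"
      using subsetD[OF V(2)] lp_opsD(2)[OF p A, of u v] seq.subspace_add[OF V(1), of u v] by auto
    then show ?thesis
      by blast
  qed
  show "seq_scale k x \<in> A ` V" if "x \<in> A ` V" for k x
  proof -
    obtain u where "u \<in> V" "x = A u"
      using \<open>x \<in> A ` V\<close> by blast
    then have "seq_scale k x = A (seq_scale k u)" "seq_scale k u \<in> V"
      using subsetD[OF V(2)] lp_opsD(3)[OF p A, of u k] seq.subspace_scale[OF V(1), of u k] by auto
    then show ?thesis
      by blast
  qed
qed

lemma finite_dim_subspace:
  assumes "seq.subspace V" "V \<subseteq> seq.span S" "finite S"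
  shows "finite_dim V"
proof -
  obtain B where B: "B \<subseteq> V" "seq.independent B" "V \<subseteq> seq.span B"
    using seq.basis_exists by metis
  have "finite B"
    using seq.independent_span_bound[OF assms(3) B(2)] B(1) assms(2) by blast
  moreover have "seq.span B = V"
    using B seq.span_minimal[OF B(1) assms(1)] by blast
  ultimately show ?thesis
    by (auto simp: finite_dim_def)
qed

lemma finite_dim_quotientI:
  assumes V: "seq.subspace V" and W: "seq.subspace W" and B: "B \<subseteq> V" "finite B"
    and ex: "\<And>y. y \<in> V \<Longrightarrow> \<exists>z\<in>seq.span B. y - z \<in> W"
  shows "finite_dim_quotient V W"
proof -
  have sub: "seq.span B \<subseteq> V"
    by (rule seq.span_minimal[OF B(1) V])
  have same: "coset_rel V W `` {y} = coset_rel V W `` {z}" if "y \<in> V" "z \<in> V" "y - z \<in> W" for y z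
  proof -
    have "y - x \<in> W \<longleftrightarrow> z - x \<in> W" for x
      using seq.subspace_diff[OF W _ that(3), of "y - x"] seq.subspace_add[OF W _ that(3), of "z - x"]
      by (auto simp: algebra_simps)
    then show ?thesis
      using that by (auto simp: coset_rel_def)
  qed
  have "seq.span B // coset_rel V W = V // coset_rel V W"
  proof
    show "seq.span B // coset_rel V W \<subseteq> V // coset_rel V W"
      using sub by (auto simp: quotient_def)
    show "V // coset_rel V W \<subseteq> seq.span B // coset_rel V W"
    proof
      fix X
      assume "X \<in> V // coset_rel V W"
      then obtain y where y: "y \<in> V" "X = coset_rel V W `` {y}"
        by (auto elim: quotientE)
      obtain z where z: "z \<in> seq.span B" "y - z \<in> W"
        using ex[OF y(1)] by blast
      then have "X = coset_rel V W `` {z}"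
        using same[OF y(1) _ z(2)] sub y(2) by blast
      then show "X \<in> seq.span B // coset_rel V W"
        using z(1) by (auto intro: quotientI)
    qed
  qed
  then show ?thesis
    using B by (auto simp: finite_dim_quotient_def)
qed

section \<open>Sequences supported on an initial segment\<close>

definition unit_seq :: "nat \<Rightarrow> nat \<Rightarrow> complex" where
  "unit_seq i = (\<lambda>n. if n = i then 1 else 0)"

definition trunc :: "nat \<Rightarrow> (nat \<Rightarrow> complex) \<Rightarrow> (nat \<Rightarrow> complex)" where
  "trunc N x = (\<lambda>n. if n \<le> N then x n else 0)"

lemma sum_seq_apply: "(\<Sum>i\<in>S. f i) n = (\<Sum>i\<in>S. f i (n::nat) :: complex)"
  by (induction S rule: infinite_finite_induct) auto

lemma trunc_eq_sum:
  assumes "x 0 = 0"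
  shows "trunc N x = (\<Sum>i\<in>{1..N}. seq_scale (x i) (unit_seq i))"
proof
  fix n
  show "trunc N x n = (\<Sum>i\<in>{1..N}. seq_scale (x i) (unit_seq i)) n"
    using assms
    by (cases "n = 0") (auto simp: sum_seq_apply trunc_def seq_scale_def unit_seq_def if_distrib cong: if_cong)
qed

lemma trunc_in_span:
  assumes "x 0 = 0"
  shows "trunc N x \<in> seq.span (unit_seq ` {1..N})"
  unfolding trunc_eq_sum[of x, OF assms] by (intro seq.span_sum seq.span_scale seq.span_base) auto

lemma trunc_lp_ops:
  assumes p: "1 < p"
  shows "trunc N \<in> lp_ops p"
proof (rule lp_opsI[OF p, where K = 1])
  fix x
  assume x: "x \<in> lp p"
  have *: "trunc N x 0 = 0" "\<And>n. n \<notin> UNIV \<Longrightarrow> trunc N x n = 0"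
    "\<And>n. n \<in> UNIV \<Longrightarrow> norm (trunc N x n) \<le> 1 * norm (x n)"
    using lp_at_0[OF x] by (auto simp: trunc_def)
  show "trunc N x \<in> lp p" "lp_norm p (trunc N x) \<le> 1 * lp_norm p x"
    using lp_reindex[OF p x _ *(1) inj_on_id2 *(2,3)] by auto
qed (auto simp: trunc_def seq_scale_def fun_eq_iff)

lemma unit_seq_lp:
  assumes "1 < p" "1 \<le> i"
  shows "unit_seq i \<in> lp p"
  by (rule lp_finite_support(1)[OF assms(1), where S = "{i}" and C = 1])
    (use assms in \<open>auto simp: unit_seq_def\<close>)

lemma span_unit_seq:
  assumes p: "1 < p" and x: "x \<in> seq.span (unit_seq ` {1..N})"
  shows "x \<in> lp p" "trunc N x = x"
proof -
  have "seq.span (unit_seq ` {1..N}) \<subseteq> {x \<in> lp p. trunc N x = x}"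
  proof (rule seq.span_minimal)
    show "unit_seq ` {1..N} \<subseteq> {x \<in> lp p. trunc N x = x}"
      using unit_seq_lp[OF p] by (auto simp: trunc_def unit_seq_def fun_eq_iff)
    show "seq.subspace {x \<in> lp p. trunc N x = x}"
      by (rule seq.subspaceI)
        (simp_all add: lp_zero lp_add[OF p] lp_scale lp_opsD[OF p trunc_lp_ops[OF p]])
  qed
  then show "x \<in> lp p" "trunc N x = x"
    using x by auto
qed

text \<open>Finite-dimensional subspaces are closed, even under coordinatewise limits. A left
  inverse of the identity on \<open>W\<close> is a linear projection \<open>g\<close> onto
  \<open>W\<close>. On the span of the first \<open>N\<close> unit sequences it is a finite
  combination of coordinates, hence continuous, and \<open>W\<close> consists of vectors fixed by
  \<open>g\<close>.\<close>

lemma span_unit_seq_closed: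
  assumes W: "seq.subspace W" "W \<subseteq> seq.span (unit_seq ` {1..N})"
    and f: "\<And>m. f m \<in> W" and y: "y \<in> seq.span (unit_seq ` {1..N})"
    and lim: "\<And>n. (\<lambda>m. f m n) \<longlonglongrightarrow> y n"
  shows "y \<in> W"
proof -
  interpret vector_space_pair seq_scale seq_scale ..
  have "Vector_Spaces.linear seq_scale seq_scale (\<lambda>x. x)"
    by (rule seq.linear_ident)
  then obtain g where g: "g ` UNIV \<subseteq> W" "Vector_Spaces.linear seq_scale seq_scale g" "\<And>v. v \<in> W \<Longrightarrow> g v = v"
    using linear_exists_left_inverse_on[OF _ W(1)] by (metis inj_on_id2)
  have g_eq: "g x n = (\<Sum>i\<in>{1..N}. x i * g (unit_seq i) n)" if "x \<in> seq.span (unit_seq ` {1..N})" for x n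
  proof -
    \<comment> \<open>The exponent 2 is an arbitrary choice above 1, made to apply
      \<open>span_unit_seq\<close>; the claim itself does not mention an exponent.\<close>
    have "x \<in> lp 2" "trunc N x = x"
      using span_unit_seq[of 2 x N] that by simp_all
    then have "x = (\<Sum>i\<in>{1..N}. seq_scale (x i) (unit_seq i))"
      using trunc_eq_sum[of x N] lp_at_0[of x 2] by simp
    then have "g x = g (\<Sum>i\<in>{1..N}. seq_scale (x i) (unit_seq i))"
      by (rule arg_cong)
    also have "\<dots> = (\<Sum>i\<in>{1..N}. seq_scale (x i) (g (unit_seq i)))"
      by (simp only: linear_sum[OF g(2)] linear_scale[OF g(2)])
    finally show ?thesis
      by (simp add: sum_seq_apply seq_scale_def)
  qed
  have "g y n = y n" for n
  proof (rule LIMSEQ_unique[OF _ lim])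
    have "(\<lambda>m. g (f m) n) \<longlonglongrightarrow> g y n"
      unfolding g_eq[OF y] using f W(2)
      by (subst g_eq) (auto intro!: tendsto_intros lim)
    then show "(\<lambda>m. f m n) \<longlonglongrightarrow> g y n"
      by (simp add: g(3) f)
  qed
  then have "g y = y"
    by blast
  then show ?thesis
    using subsetD[OF g(1) imageI[of y UNIV g]] by simp
qed

text \<open>
  With \<open>P = trunc N\<close>, a vector \<open>y\<close> is in the range of \<open>A + F\<close> iff \<open>P A\<^sup>-\<^sup>1 y\<close> is in the range of
  \<open>I + P A\<^sup>-\<^sup>1 F\<close> on the finite-dimensional space of sequences supported in \<open>{1..N}\<close>.
\<close>

lemma lp_fredholm_finite_perturbation:
  assumes p: "1 < p" and A: "lp_invertible p A" and F: "F \<in> lp_ops p"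
    and F_trunc: "\<And>x. x \<in> lp p \<Longrightarrow> F (trunc N x) = F x"
    and trunc_F: "\<And>x. x \<in> lp p \<Longrightarrow> trunc N (F x) = F x"
  shows "lp_fredholm p (\<lambda>x. A x + F x)"
proof -
  from A obtain B where A': "A \<in> lp_ops p" and B: "B \<in> lp_ops p"
    and BA: "\<And>x. x \<in> lp p \<Longrightarrow> B (A x) = x" and AB: "\<And>x. x \<in> lp p \<Longrightarrow> A (B x) = x"
    by (auto simp: lp_invertible_def)
  define E where "E = unit_seq ` {1..N}"
  define P where "P = trunc N"
  define V where "V = seq.span E"
  define G where "G x = A x + F x" for x
  note AD = lp_opsD[OF p A'] and BD = lp_opsD[OF p B] and FD = lp_opsD[OF p F]
    and PD = lp_opsD[OF p trunc_lp_ops[OF p, of N], folded P_def]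
  have G: "G \<in> lp_ops p"
    unfolding G_def[abs_def] by (rule lp_ops_add[OF p A' F])
  note GD = lp_opsD[OF p G]
  have fin: "finite E" and E: "E \<subseteq> lp p"
    using unit_seq_lp[OF p] by (auto simp: E_def)
  have PV: "P x \<in> V" if "x \<in> lp p" for x
    unfolding P_def V_def E_def using that by (intro trunc_in_span lp_at_0)
  have V: "x \<in> lp p" "P x = x" if "x \<in> V" for x
    using span_unit_seq[OF p, of x N] that by (auto simp: V_def E_def P_def)
  have FV: "F x \<in> V" if "x \<in> lp p" for x
    using PV[OF FD(1)[OF that]] trunc_F[OF that] by (simp add: P_def)
  have FP: "F (P x) = F x" if "x \<in> lp p" for x
    using F_trunc[OF that] by (simp add: P_def)
  have range: "lp_range p G = G ` lp p"
    by (simp add: lp_range_def)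
  define L where "L x = x + P (B (F x))" for x
  have L: "L \<in> lp_ops p"
    unfolding L_def[abs_def] P_def
    by (intro lp_ops_add lp_ops_id lp_ops_compose[OF p trunc_lp_ops] lp_ops_compose[OF p B F] p)
  define W where "W = L ` V"
  have W_sub: "seq.subspace W" "W \<subseteq> V"
  proof -
    show "seq.subspace W"
      unfolding W_def by (rule lp_ops_subspace_image[OF p L]) (use V in \<open>auto simp: V_def\<close>)
    show "W \<subseteq> V"
      unfolding W_def L_def V_def
      using V PV by (auto intro!: seq.span_add simp: V_def BD FD)
  qed
  have in_range: "y \<in> G ` lp p \<longleftrightarrow> P (B y) \<in> W" if y: "y \<in> lp p" for y
  proof
    assume "y \<in> G ` lp p"
    then obtain x where x: "x \<in> lp p" "y = A x + F x"
      by (auto simp: G_def)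
    have "B y = x + B (F x)"
      using x BA by (simp add: BD AD FD del: plus_fun_apply)
    then have "P (B y) = L (P x)"
      using x by (simp add: L_def PD BD FD FP del: plus_fun_apply)
    then show "P (B y) \<in> W"
      using PV[OF x(1)] by (auto simp: W_def)
  next
    assume "P (B y) \<in> W"
    then obtain v where v: "v \<in> V" "P (B y) = v + P (B (F v))"
      by (auto simp: W_def L_def)
    \<comment> \<open>This choice is forced: \<open>G x = y\<close> means
      \<open>x = B y - B (F x)\<close>, and \<open>F x\<close> depends only on \<open>P x\<close>,
      which is to be \<open>v\<close>.\<close>
    define x where "x = B y - B (F v)"
    have x: "x \<in> lp p"
      unfolding x_def by (intro lp_diff[OF p] BD FD V(1) v y)
    have "P x = v"
      using v y V(1)[OF v(1)] by (simp add: x_def PD BD FD)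
    then have "F x = F v"
      using FP[OF x] by simp
    moreover have "A x = y - F v"
      using v y V(1)[OF v(1)] by (simp add: x_def AD BD FD AB)
    ultimately have "y = G x"
      by (simp add: G_def)
    then show "y \<in> G ` lp p"
      using x by blast
  qed
  have closed: "closedin (Metric_space.mtopology (lp p) (lp_dist p)) (lp_range p G)"
    unfolding lp_closedin_iff[OF p] range
  proof (intro conjI allI impI; (elim conjE)?)
    show "G ` lp p \<subseteq> lp p"
      using GD by blast
    fix f y
    assume f: "\<forall>m. f m \<in> G ` lp p" and y: "y \<in> lp p" and lim: "(\<lambda>m. lp_norm p (f m - y)) \<longlonglongrightarrow> 0"
    have flp: "f m \<in> lp p" for m
      using f GD(1) by (metis imageE)
    obtain K where K: "\<And>x. x \<in> lp p \<Longrightarrow> lp_norm p (B x) \<le> K * lp_norm p x"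
      using lp_ops_bound[OF p B] by blast
    have "(\<lambda>m. lp_norm p (B (f m) - B y)) \<longlonglongrightarrow> 0"
    proof (rule tendsto_sandwich[OF _ _ tendsto_const tendsto_mult_right_zero[OF lim, of K]])
      show "\<forall>\<^sub>F m in sequentially. lp_norm p (B (f m) - B y) \<le> K * lp_norm p (f m - y)"
        using K[OF lp_diff[OF p flp y]] by (simp add: BD flp y)
    qed auto
    then have "(\<lambda>m. B (f m) n) \<longlonglongrightarrow> B y n" for n
      by (intro lp_tendsto_pointwise[OF p] BD flp y)
    then have "(\<lambda>m. P (B (f m)) n) \<longlonglongrightarrow> P (B y) n" for n
      by (simp add: P_def trunc_def)
    then have "P (B y) \<in> W"
      using span_unit_seq_closed[of W N "\<lambda>m. P (B (f m))" "P (B y)"] W_sub f in_range flp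
        PV[OF BD(1)[OF y]]
      by (simp add: V_def E_def)
    then show "y \<in> G ` lp p"
      using in_range[OF y] by simp
  qed
  have kernel: "finite_dim (lp_kernel p G)"
  proof (rule finite_dim_subspace)
    show "seq.subspace (lp_kernel p G)"
      by (rule seq.subspaceI) (auto simp: lp_kernel_def lp_zero lp_add[OF p] lp_scale GD)
    show "finite (B ` E)"
      using fin by simp
    \<comment> \<open>A kernel vector satisfies \<open>x = - B (F x)\<close>, and \<open>F x\<close>
      lies in the span of \<open>E\<close>.\<close>
    show "lp_kernel p G \<subseteq> seq.span (B ` E)"
    proof
      fix x
      assume "x \<in> lp_kernel p G"
      then have x: "x \<in> lp p" "A x + F x = 0"
        by (auto simp: lp_kernel_def G_def)
      have "B (A x + F x) = 0"
        by (simp add: x(2) BD)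
      then have "x + B (F x) = 0"
        using x(1) BA by (simp add: BD AD FD del: plus_fun_apply)
      then have "x = - B (F x)"
        by (simp add: eq_neg_iff_add_eq_0)
      moreover have "B (F x) \<in> seq.span (B ` E)"
        using lp_ops_span[OF p B E] FV[OF x(1)] by (simp add: V_def)
      ultimately show "x \<in> seq.span (B ` E)"
        using seq.span_neg by metis
    qed
  qed
  have quot: "finite_dim_quotient (lp p) (lp_range p G)"
    unfolding range
  proof (rule finite_dim_quotientI)
    show "seq.subspace (lp p)" "seq.subspace (G ` lp p)"
      using lp_subspace[OF p] lp_ops_subspace_image[OF p G] by auto
    show "A ` E \<subseteq> lp p" "finite (A ` E)"
      using E AD fin by auto
    fix y
    assume y: "y \<in> lp p"
    \<comment> \<open>Removing the part of \<open>B y\<close> that \<open>F\<close> can see gives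
      \<open>F x = 0\<close>. Then \<open>G x = A x\<close> differs from \<open>y\<close> only by
      \<open>A (P (B y))\<close>.\<close>
    define x where "x = B y - P (B y)"
    have x: "x \<in> lp p"
      unfolding x_def by (intro lp_diff[OF p] BD PD y)
    have PP: "P (P (B y)) = P (B y)"
      using V(2) PV BD(1) y by simp
    have "P x = 0"
      unfolding x_def using y PP by (simp add: PD BD)
    then have "F x = 0"
      using FP[OF x] FD(5) by simp
    then have "G x = y - A (P (B y))"
      using y AB by (simp add: G_def x_def AD PD BD)
    moreover have "A (P (B y)) \<in> seq.span (A ` E)"
      using lp_ops_span[OF p A' E] PV[OF BD(1)[OF y]] by (simp add: V_def)
    ultimately show "\<exists>z\<in>seq.span (A ` E). y - z \<in> G ` lp p"
      using x by (metis imageI)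
  qed
  show ?thesis
    using G closed kernel quot unfolding lp_fredholm_def G_def[abs_def] by blast
qed

text \<open>This is the perturbation result with \<open>F = 0\<close> and \<open>N = 0\<close>. It
  transfers failure of the Fredholm property for the limiting operator to its spectrum.\<close>

lemma lp_invertible_imp_fredholm:
  assumes p: "1 < p" and A: "lp_invertible p A"
  shows "lp_fredholm p A"
proof -
  have "(\<lambda>x. 0) \<in> lp_ops p"
    by (rule lp_opsI[OF p, where K = 0]) (auto simp: lp_zero)
  then have "lp_fredholm p (\<lambda>x. A x + 0)"
    by (intro lp_fredholm_finite_perturbation[OF p A, where N = 0])
      (auto simp: trunc_def fun_eq_iff)
  then show ?thesis
    by simp
qed

section \<open>Invertibility off the intervals\<close>

lemma op_T_add: "op_T a b c (x + y) = op_T a b c x + op_T a b c y"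
  by (auto simp: op_T_def fun_eq_iff algebra_simps)

lemma op_T_scale: "op_T a b c (seq_scale k x) = seq_scale k (op_T a b c x)"
  by (auto simp: op_T_def seq_scale_def fun_eq_iff algebra_simps)

lemma op_T_diff: "op_T a b c (x - y) = op_T a b c x - op_T a b c y"
  by (auto simp: op_T_def fun_eq_iff algebra_simps)

lemma op_T_coeff_add:
  "op_T (\<lambda>n. a n + a' n) (\<lambda>n. b n + b' n) (\<lambda>n. c n + c' n) x = op_T a b c x + op_T a' b' c' x"
  by (auto simp: op_T_def fun_eq_iff algebra_simps)

lemma op_T_bounded:
  assumes p: "1 < p" and x: "x \<in> lp p"
    and a: "\<And>n. norm (a n) \<le> A" and b: "\<And>n. norm (b n) \<le> B" and c: "\<And>n. norm (c n) \<le> C"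
  shows "op_T a b c x \<in> lp p" "lp_norm p (op_T a b c x) \<le> (A + B + C) * lp_norm p x"
proof -
  have nonneg: "0 \<le> A" "0 \<le> B" "0 \<le> C"
    using a b c norm_ge_zero order_trans by blast+
  \<comment> \<open>One sequence per diagonal. \<open>w\<close> must be set to 0 at index 0, where
    the shift would otherwise put \<open>b 0 * x 2\<close>; \<open>v\<close> vanishes there because
    \<open>x 0 = 0\<close>.\<close>
  define u v w where "u n = (if n \<le> 2 then 0 else c (n - 2) * x (n - 2))"
    and "v n = a n * x n" and "w n = (if n = 0 then 0 else b n * x (n + 2))" for n
  have u: "u \<in> lp p \<and> lp_norm p u \<le> C * lp_norm p x"
    by (intro conjI lp_reindex[OF p x nonneg(3), where S = "{2<..}" and f = "\<lambda>n. n - 2"];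
        auto simp: u_def norm_mult c mult_right_mono inj_on_def)
  have v: "v \<in> lp p \<and> lp_norm p v \<le> A * lp_norm p x"
    by (intro conjI lp_reindex[OF p x nonneg(1), where S = UNIV and f = "\<lambda>n. n"];
        (auto simp: v_def norm_mult a mult_right_mono lp_at_0[OF x])?)
  have w: "w \<in> lp p \<and> lp_norm p w \<le> B * lp_norm p x"
    by (intro conjI lp_reindex[OF p x nonneg(2), where S = UNIV and f = "\<lambda>n. n + 2"];
        (auto simp: w_def norm_mult b mult_right_mono nonneg inj_on_def)?)
  have eq: "op_T a b c x = u + v + w"
    by (auto simp: op_T_def u_def v_def w_def fun_eq_iff lp_at_0[OF x])
  show "op_T a b c x \<in> lp p"
    unfolding eq by (intro lp_add[OF p] u[THEN conjunct1] v[THEN conjunct1] w[THEN conjunct1])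
  have "lp_norm p (u + v + w) \<le> lp_norm p u + lp_norm p v + lp_norm p w"
    using lp_norm_triangle[OF p, of u v] lp_norm_triangle[OF p, of "u + v" w] lp_add[OF p, of u v] u v w
    by simp
  then show "lp_norm p (op_T a b c x) \<le> (A + B + C) * lp_norm p x"
    unfolding eq using u v w by (simp add: algebra_simps)
qed

lemma op_T_lp_ops:
  assumes p: "1 < p" and "Bseq a" "Bseq b" "Bseq c"
  shows "op_T a b c \<in> lp_ops p"
proof -
  obtain A B C where "\<And>n. norm (a n) \<le> A" "\<And>n. norm (b n) \<le> B" "\<And>n. norm (c n) \<le> C"
    using assms(2-4) unfolding Bseq_def by metis
  then show ?thesis
    by (intro lp_opsI[OF p, where K = "A + B + C"] op_T_bounded[OF p])
      (simp_all add: op_T_add op_T_scale)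
qed

lemma lp_fredholm_op_T_perturbation:
  assumes p: "1 < p" and A: "lp_invertible p A" and lim: "a \<longlonglongrightarrow> 0" "b \<longlonglongrightarrow> 0" "c \<longlonglongrightarrow> 0"
  shows "lp_fredholm p (\<lambda>x. A x + op_T a b c x)"
proof -
  obtain \<delta> where \<delta>: "0 < \<delta>" "\<And>K. K \<in> lp_ops p \<Longrightarrow>
      (\<And>x. x \<in> lp p \<Longrightarrow> lp_norm p (K x) \<le> \<delta> * lp_norm p x) \<Longrightarrow> lp_invertible p (\<lambda>x. A x + K x)"
    using lp_invertible_perturb[OF p A] by blast
  \<comment> \<open>A third of \<delta> for each of the three diagonals, matching the bound
    \<open>A + B + C\<close> in \<open>op_T_bounded\<close>.\<close>
  have "\<forall>\<^sub>F n in sequentially. norm (a n) < \<delta> / 3 \<and> norm (b n) < \<delta> / 3 \<and> norm (c n) < \<delta> / 3"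
    using \<delta>(1) tendstoD[OF lim(1), of "\<delta> / 3"] tendstoD[OF lim(2), of "\<delta> / 3"]
      tendstoD[OF lim(3), of "\<delta> / 3"]
    by (intro eventually_conj) simp_all
  then obtain N where N: "\<And>n. N \<le> n \<Longrightarrow> norm (a n) < \<delta> / 3"
    "\<And>n. N \<le> n \<Longrightarrow> norm (b n) < \<delta> / 3" "\<And>n. N \<le> n \<Longrightarrow> norm (c n) < \<delta> / 3"
    by (auto simp: eventually_sequentially)
  define head tail :: "(nat \<Rightarrow> complex) \<Rightarrow> nat \<Rightarrow> complex" where
    "head f n = (if n < N then f n else 0)" and "tail f n = (if n < N then 0 else f n)" for f n
  have bdd: "Bseq a" "Bseq b" "Bseq c"
    using lim by (auto intro!: convergent_imp_Bseq convergentI)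
  have Bseq: "Bseq (head f)" "Bseq (tail f)" if f: "Bseq f" for f
  proof -
    obtain K where "0 < K" "\<And>n. norm (f n) \<le> K"
      using f by (auto elim: BseqE)
    then show "Bseq (head f)" "Bseq (tail f)"
      by (auto intro!: BseqI'[where K = K] simp: head_def tail_def)
  qed
  define K where "K = op_T (tail a) (tail b) (tail c)"
  define F where "F = op_T (head a) (head b) (head c)"
  have K: "K \<in> lp_ops p" and F: "F \<in> lp_ops p"
    unfolding K_def F_def by (intro op_T_lp_ops[OF p] Bseq bdd)+
  have "lp_norm p (K x) \<le> \<delta> * lp_norm p x" if x: "x \<in> lp p" for x
  proof -
    have "norm (tail a n) \<le> \<delta> / 3" "norm (tail b n) \<le> \<delta> / 3" "norm (tail c n) \<le> \<delta> / 3" for n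
      using N[of n] \<delta>(1) by (auto simp: tail_def)
    from op_T_bounded(2)[OF p x this] show ?thesis
      by (simp add: K_def)
  qed
  then have inv: "lp_invertible p (\<lambda>x. A x + K x)"
    by (intro \<delta>(2) K)
  have "lp_fredholm p (\<lambda>x. (A x + K x) + F x)"
  proof (rule lp_fredholm_finite_perturbation[OF p inv F, where N = "N + 2"])
    \<comment> \<open>Coefficients of index below \<open>N\<close> read entries up to N + 1, through
      \<open>x (n + 2)\<close>, and write entries up to N + 1, through
      \<open>c (n - 2)\<close>.\<close>
    show "F (trunc (N + 2) x) = F x" "trunc (N + 2) (F x) = F x" for x
      by (auto simp: F_def op_T_def head_def trunc_def fun_eq_iff)
  qed
  moreover have "K x + F x = op_T a b c x" for x
    unfolding K_def F_def op_T_coeff_add[symmetric] by (auto simp: head_def tail_def if_distrib cong: if_cong)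
  ultimately show ?thesis
    by (simp add: add.assoc)
qed

text \<open>The roots of z^2 - \<mu> z + 1 have product 1, so one of them lies inside the unit disc
  unless both lie on the circle. In that case they are conjugate, and \<mu> = 2 Re z would lie in
  [-2, 2].\<close>

lemma joukowski_inverse:
  assumes "\<mu> \<notin> complex_of_real ` {-2..2}"
  obtains z where "z \<noteq> 0" "norm z < 1" "z + 1 / z = \<mu>"
proof -
  define w where "w = csqrt (\<mu>\<^sup>2 - 4)"
  define z1 where "z1 = (\<mu> + w) / 2"
  define z2 where "z2 = (\<mu> - w) / 2"
  have w2: "w\<^sup>2 = \<mu>\<^sup>2 - 4"
    by (simp add: w_def)
  have "4 * (z1 * z2) = \<mu>\<^sup>2 - w\<^sup>2"
    by (simp add: z1_def z2_def field_simps power2_eq_square)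
  then have prod: "z1 * z2 = 1"
    by (simp add: w2)
  have sum: "z1 + z2 = \<mu>"
    by (simp add: z1_def z2_def field_simps)
  have ne: "z1 \<noteq> 0" "z2 \<noteq> 0"
    using prod by auto
  have inv: "1 / z1 = z2" "1 / z2 = z1"
    using prod ne by (simp_all add: field_simps)
  have norms: "norm z1 * norm z2 = 1"
    using prod by (simp flip: norm_mult)
  have "norm z1 \<noteq> 1"
  proof
    assume n: "norm z1 = 1"
    then have "z1 * cnj z1 = 1"
      by (simp add: complex_norm_square[symmetric])
    then have "z2 = cnj z1"
      using prod ne by (metis mult_left_cancel)
    then have "\<mu> = complex_of_real (2 * Re z1)"
      using sum complex_add_cnj[of z1] by simp
    moreover have "2 * Re z1 \<in> {-2..2}"
      unfolding atLeastAtMost_iff using abs_Re_le_cmod[of z1] n by linarith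
    ultimately show False
      using assms by blast
  qed
  then consider "norm z1 < 1" | "1 < norm z1"
    by linarith
  then show thesis
  proof cases
    case 1
    then show thesis
      using that[of z1] ne inv sum by simp
  next
    case 2
    have "norm z2 < norm z1 * norm z2"
      using 2 ne by simp
    then show thesis
      using that[of z2] ne inv sum norms by (simp add: add.commute)
  qed
qed

definition parity_seq :: "complex \<Rightarrow> complex \<Rightarrow> nat \<Rightarrow> complex" where
  "parity_seq u v n = (if odd n then u else v)"

lemma Bseq_parity_seq: "Bseq (parity_seq u v)"
  by (rule BseqI'[where K = "max (norm u) (norm v)"]) (auto simp: parity_seq_def)

text \<open>
  If \<open>z + 1 / z = \<mu>\<close> then \<open>S + S\<^sup>* - \<mu> = - (I - z S\<^sup>*) (I - z S) / z\<close> for the shift \<open>S\<close> (by two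
  places), since \<open>S\<^sup>* S = I\<close>; for \<open>norm z < 1\<close> both factors are Neumann-invertible.
\<close>

lemma lp_invertible_parity_op_T:
  assumes p: "1 < p" and s: "s1 \<noteq> 0" "s2 \<noteq> 0"
    and z1: "z1 \<noteq> 0" "norm z1 < 1" and z2: "z2 \<noteq> 0" "norm z2 < 1"
  shows "lp_invertible p (op_T (parity_seq (- s1 * (z1 + 1 / z1)) (- s2 * (z2 + 1 / z2)))
    (parity_seq s1 s2) (parity_seq s1 s2))"
proof -
  define z where "z = parity_seq z1 z2"
  define q where "q = max (norm z1) (norm z2)"
  have q: "q < 1" "norm (z n) \<le> q" for n
    using z1 z2 by (auto simp: q_def z_def parity_seq_def)
  \<comment> \<open>\<open>R\<close> and \<open>L\<close> are the forward and the backward shift by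
    two places, weighted by \<open>z\<close>; \<open>D\<close> is the outer factor -s / z. All
    weights depend only on parity, so they commute with both shifts.\<close>
  define R where "R = op_T (\<lambda>_. 0) (\<lambda>_. 0) z"
  define L where "L = op_T (\<lambda>_. 0) z (\<lambda>_. 0)"
  define D where "D = op_T (parity_seq (- s1 / z1) (- s2 / z2)) (\<lambda>_. 0) (\<lambda>_. 0)"
  define D' where "D' = op_T (parity_seq (- z1 / s1) (- z2 / s2)) (\<lambda>_. 0) (\<lambda>_. 0)"
  have const: "Bseq (\<lambda>_. 0 :: complex)" and zB: "Bseq z"
    using Bseq_parity_seq by (auto simp: z_def Bfun_const)
  note ops = op_T_lp_ops[OF p]
  have "lp_invertible p (\<lambda>x. x - R x)"
  proof (rule lp_neumann[OF p _ q(1)])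
    show "R \<in> lp_ops p"
      unfolding R_def by (intro ops const zB)
    show "lp_norm p (R x) \<le> q * lp_norm p x" if "x \<in> lp p" for x
      using op_T_bounded(2)[OF p that, of "\<lambda>_. 0" 0 "\<lambda>_. 0" 0 z q] q by (simp add: R_def)
  qed
  moreover have "lp_invertible p (\<lambda>x. x - L x)"
  proof (rule lp_neumann[OF p _ q(1)])
    show "L \<in> lp_ops p"
      unfolding L_def by (intro ops const zB)
    show "lp_norm p (L x) \<le> q * lp_norm p x" if "x \<in> lp p" for x
      using op_T_bounded(2)[OF p that, of "\<lambda>_. 0" 0 z q "\<lambda>_. 0" 0] q by (simp add: L_def)
  qed
  moreover have "lp_invertible p D"
    unfolding lp_invertible_def
  proof (intro conjI bexI[of _ D'] ballI)
    show "D \<in> lp_ops p" "D' \<in> lp_ops p"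
      unfolding D_def D'_def by (intro ops const Bseq_parity_seq)+
    show "D' (D x) = x" "D (D' x) = x" if "x \<in> lp p" for x
      using s z1 z2 lp_at_0[OF that]
      by (auto simp: D_def D'_def op_T_def parity_seq_def fun_eq_iff)
  qed
  ultimately have "lp_invertible p (\<lambda>x. D ((x - R x) - L (x - R x)))"
    using lp_invertible_compose[OF p, of D "\<lambda>x. (x - R x) - L (x - R x)"]
      lp_invertible_compose[OF p, of "\<lambda>x. x - L x" "\<lambda>x. x - R x"] by simp
  \<comment> \<open>The order matters: \<open>L\<close> after \<open>R\<close> multiplies every
    entry by z^2, whereas \<open>R\<close> after \<open>L\<close> would lose the first two
    entries.\<close>
  moreover have "D ((x - R x) - L (x - R x)) = op_T (parity_seq (- s1 * (z1 + 1 / z1))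
      (- s2 * (z2 + 1 / z2))) (parity_seq s1 s2) (parity_seq s1 s2) x" for x
    using s z1 z2
    by (auto simp: D_def L_def R_def z_def op_T_def parity_seq_def fun_eq_iff field_simps)
  ultimately show ?thesis
    by simp
qed

lemma not_in_scaled_interval:
  assumes "0 < s" "\<zeta> \<notin> complex_of_real ` {r - 2 * s..r + 2 * s}"
  shows "(\<zeta> - complex_of_real r) / complex_of_real s \<notin> complex_of_real ` {-2..2}"
proof
  assume "(\<zeta> - complex_of_real r) / complex_of_real s \<in> complex_of_real ` {-2..2}"
  then obtain t where t: "-2 \<le> t" "t \<le> 2" "(\<zeta> - complex_of_real r) / complex_of_real s = complex_of_real t"
    by auto
  then have "\<zeta> = complex_of_real (r + t * s)"
    using assms(1) by (simp add: field_simps)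
  moreover have "r + t * s \<in> {r - 2 * s..r + 2 * s}"
    using t assms(1) mult_right_mono[of "-2" t s] mult_right_mono[of t 2 s] by simp
  ultimately show False
    using assms(2) by blast
qed

lemma lp_invertible_outside_intervals:
  assumes p: "1 < p" and s: "0 < s1" "0 < s2"
    and "\<zeta> \<notin> complex_of_real ` ({r1 - 2 * s1..r1 + 2 * s1} \<union> {r2 - 2 * s2..r2 + 2 * s2})"
  shows "lp_invertible p (op_T (\<lambda>n. parity_seq r1 r2 n - \<zeta>) (parity_seq s1 s2) (parity_seq s1 s2))"
proof -
  obtain z1 where z1: "z1 \<noteq> 0" "norm z1 < 1" "z1 + 1 / z1 = (\<zeta> - complex_of_real r1) / complex_of_real s1"
    using joukowski_inverse[OF not_in_scaled_interval[OF s(1), of \<zeta> r1]] assms(4) by blast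
  obtain z2 where z2: "z2 \<noteq> 0" "norm z2 < 1" "z2 + 1 / z2 = (\<zeta> - complex_of_real r2) / complex_of_real s2"
    using joukowski_inverse[OF not_in_scaled_interval[OF s(2), of \<zeta> r2]] assms(4) by blast
  have "(\<lambda>n. parity_seq r1 r2 n - \<zeta>) = parity_seq (- s1 * (z1 + 1 / z1)) (- s2 * (z2 + 1 / z2))"
    unfolding z1(3) z2(3) using s by (auto simp: parity_seq_def fun_eq_iff)
  then show ?thesis
    using lp_invertible_parity_op_T[OF p _ _ z1(1,2) z2(1,2), of s1 s2] s by simp
qed

section \<open>Weyl sequences on the intervals\<close>

definition spread :: "nat \<Rightarrow> (nat \<Rightarrow> complex) \<Rightarrow> nat \<Rightarrow> complex" where
  "spread e v n = (if e \<le> n \<and> even (n - e) then v ((n - e) div 2) else 0)"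

lemma spread_apply [simp]: "spread e v (2 * j + e) = v j"
  by (simp add: spread_def)

lemma spread_eq_0:
  assumes "\<And>j. n \<noteq> 2 * j + e"
  shows "spread e v n = 0"
  using assms[of "(n - e) div 2"] by (auto simp: spread_def)

lemma spread_eqI:
  assumes "\<And>j. x (2 * j + e) = v j" "\<And>n. (\<And>j. n \<noteq> 2 * j + e) \<Longrightarrow> x n = 0"
  shows "x = spread e v"
proof
  fix n
  show "x n = spread e v n"
  proof (cases "\<exists>j. n = 2 * j + e")
    case True
    then show ?thesis
      using assms(1) by auto
  next
    case False
    then show ?thesis
      using assms(2)[of n] spread_eq_0[of n e v] by auto
  qed
qed

lemma norm_spread_le:
  assumes "0 \<le> C" "\<And>j. norm (v j) \<le> C"
  shows "norm (spread e v n) \<le> C"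
  using assms by (simp add: spread_def)

text \<open>Two places in n are one step in j, so on each class the operator is tridiagonal.
  Numbering the even class from 2 keeps index 0 free and makes the boundary case
  \<open>n \<le> 2\<close> equivalent to \<open>j = 0\<close> for both values of
  \<open>e\<close>.\<close>

lemma op_T_spread:
  assumes e: "e \<in> {1, 2}"
  shows "op_T a b c (spread e v) = spread e (\<lambda>j. (if j = 0 then 0 else c (2 * (j - 1) + e) * v (j - 1))
    + a (2 * j + e) * v j + b (2 * j + e) * v (j + 1))"
proof (rule spread_eqI)
  fix j
  have "2 * j + e + 2 = 2 * (j + 1) + e"
    by simp
  then have 1: "spread e v (2 * j + e + 2) = v (j + 1)"
    by (simp only: spread_apply)
  show "op_T a b c (spread e v) (2 * j + e) = (if j = 0 then 0 else c (2 * (j - 1) + e) * v (j - 1))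
      + a (2 * j + e) * v j + b (2 * j + e) * v (j + 1)"
  proof (cases j)
    case 0
    then show ?thesis
      using e 1 spread_apply[of e v 0] by (auto simp: op_T_def)
  next
    case (Suc i)
    have "2 * j + e - 2 = 2 * i + e"
      using Suc by simp
    then have "spread e v (2 * j + e - 2) = v i" "c (2 * j + e - 2) = c (2 * i + e)"
      by (simp_all only: spread_apply)
    moreover have "e \<noteq> 0"
      using e by auto
    ultimately show ?thesis
      using 1 Suc spread_apply[of e v j] unfolding op_T_def by simp
  qed
next
  fix n
  assume n: "\<And>j. n \<noteq> 2 * j + e"
  show "op_T a b c (spread e v) n = 0"
  proof (cases "n = 0")
    case False
    have "spread e v n = 0"
      by (rule spread_eq_0[OF n])
    moreover have "spread e v (n + 2) = 0"
    proof (rule spread_eq_0)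
      show "n + 2 \<noteq> 2 * j + e" for j
        using n[of "j - 1"] False e by (cases j) auto
    qed
    moreover have "spread e v (n - 2) = 0" if "2 < n"
    proof (rule spread_eq_0)
      show "n - 2 \<noteq> 2 * j + e" for j
        using n[of "j + 1"] that by auto
    qed
    ultimately show ?thesis
      by (simp add: op_T_def)
  qed (simp add: op_T_def)
qed

lemma inj_on_double_add: "inj_on (\<lambda>j. 2 * j + e) (A :: nat set)"
  by (auto simp: inj_on_def)

lemma lp_spread:
  assumes p: "1 < p" and e: "0 < e" and S: "finite S" "\<And>j. j \<notin> S \<Longrightarrow> v j = 0"
    and C: "0 \<le> C" "\<And>j. norm (v j) \<le> C"
  shows "spread e v \<in> lp p" "lp_norm p (spread e v) \<le> real (card S) powr (1 / p) * C"
proof -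
  have out: "spread e v n = 0" if n: "n \<notin> (\<lambda>j. 2 * j + e) ` S" for n
  proof (cases "\<exists>j. n = 2 * j + e")
    case True
    then obtain j where "n = 2 * j + e"
      by blast
    moreover from this have "j \<notin> S"
      using n by blast
    ultimately show ?thesis
      using S(2) by simp
  qed (auto intro: spread_eq_0)
  note * = lp_finite_support[of p "(\<lambda>j. 2 * j + e) ` S" C "spread e v", OF p _ _ C(1) out norm_spread_le[OF C]]
  have "card ((\<lambda>j. 2 * j + e) ` S) = card S"
    by (rule card_image[OF inj_on_double_add])
  moreover have "0 \<notin> (\<lambda>j. 2 * j + e) ` S"
    using e by auto
  ultimately show "spread e v \<in> lp p" "lp_norm p (spread e v) \<le> real (card S) powr (1 / p) * C"
    using * S(1) by auto
qed

lemma le_lp_norm_spread: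
  assumes p: "1 < p" and x: "spread e v \<in> lp p" and S: "finite S" "\<And>j. j \<in> S \<Longrightarrow> norm (v j) = t"
    and t: "0 \<le> t"
  shows "real (card S) powr (1 / p) * t \<le> lp_norm p (spread e v)"
proof -
  have "(real (card S) powr (1 / p) * t) powr p = (\<Sum>j\<in>S. norm (v j) powr p)"
    using S p by (simp add: powr_mult powr_powr)
  also have "\<dots> = (\<Sum>n\<in>(\<lambda>j. 2 * j + e) ` S. norm (spread e v n) powr p)"
    by (subst sum.reindex[OF inj_on_double_add]) simp
  also have "\<dots> \<le> lp_norm p (spread e v) powr p"
    using S by (intro sum_le_lp_norm_powr[OF p x]) simp
  finally show ?thesis
    using p powr_less_mono2[of p "lp_norm p (spread e v)" "real (card S) powr (1 / p) * t"] by force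
qed

text \<open>\<open>cis \<theta>\<close> is a root of 1 - 2 z cos \<theta> + z^2.\<close>

lemma cis_recurrence: "cis \<theta> ^ j - 2 * complex_of_real (cos \<theta>) * cis \<theta> ^ Suc j + cis \<theta> ^ Suc (Suc j) = 0"
proof -
  have "1 - 2 * complex_of_real (cos \<theta>) * cis \<theta> + cis \<theta> * cis \<theta> = 0"
    using sin_cos_squared_add[of \<theta>] by (auto simp: complex_eq_iff algebra_simps power2_eq_square)
  moreover have "cis \<theta> ^ j - 2 * complex_of_real (cos \<theta>) * cis \<theta> ^ Suc j + cis \<theta> ^ Suc (Suc j)
      = cis \<theta> ^ j * (1 - 2 * complex_of_real (cos \<theta>) * cis \<theta> + cis \<theta> * cis \<theta>)"
    by (simp add: algebra_simps)
  ultimately show ?thesis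
    by simp
qed

text \<open>
  The humps are truncated plane waves: \<open>cis \<theta> ^ j\<close> solves the limiting recurrence, so a wave
  of length \<open>L\<close> with norm \<open>R\<close> is mapped by the limiting operator to a vector carried by four points,
  with entries of size \<open>R L\<^sup>-\<^sup>1\<^sup>/\<^sup>p\<close>.
\<close>

lemma weyl_hump:
  fixes s \<theta> :: real
  assumes p: "1 < p" and e: "e \<in> {1, 2}" and s: "0 < s"
    and a: "(\<lambda>j. a (2 * j + e)) \<longlonglongrightarrow> - 2 * complex_of_real s * complex_of_real (cos \<theta>)"
    and b: "(\<lambda>j. b (2 * j + e)) \<longlonglongrightarrow> complex_of_real s"
    and c: "(\<lambda>j. c (2 * j + e)) \<longlonglongrightarrow> complex_of_real s"
    and R: "0 < R" and \<epsilon>: "0 < \<epsilon>"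
  shows "\<exists>u K. u \<in> lp p \<and> N \<le> K \<and> (\<forall>n. u n \<noteq> 0 \<longrightarrow> (\<exists>j. n = 2 * j + e \<and> N \<le> j \<and> j < K))
    \<and> R \<le> lp_norm p u \<and> lp_norm p (op_T a b c u) \<le> \<epsilon>"
proof -
  define d where "d = - 2 * complex_of_real s * complex_of_real (cos \<theta>)"
  \<comment> \<open>Three diagonals with error at most \<delta>, acting on a vector of norm at most
    \<open>R\<close>, cost 3 \<delta> R = \<epsilon> / 2.\<close>
  define \<delta> where "\<delta> = \<epsilon> / (6 * R)"
  have \<delta>: "0 < \<delta>"
    using R \<epsilon> by (simp add: \<delta>_def)
  have "\<forall>\<^sub>F j in sequentially. dist (a (2 * j + e)) d < \<delta> \<and> dist (b (2 * j + e)) s < \<delta>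
      \<and> dist (c (2 * j + e)) s < \<delta>"
    unfolding d_def by (intro eventually_conj tendstoD[OF a \<delta>] tendstoD[OF b \<delta>] tendstoD[OF c \<delta>])
  then obtain M0 where M0: "\<And>j. M0 \<le> j \<Longrightarrow> norm (a (2 * j + e) - d) < \<delta>"
    "\<And>j. M0 \<le> j \<Longrightarrow> norm (b (2 * j + e) - s) < \<delta>" "\<And>j. M0 \<le> j \<Longrightarrow> norm (c (2 * j + e) - s) < \<delta>"
    by (auto simp: eventually_sequentially dist_norm)
  define M where "M = M0 + N + 1"
  \<comment> \<open>The other half of \<epsilon> is for the ends of the wave: at most four entries
    of size at most 4 s t, hence norm at most 16 s t for every p > 1. With t = R / L^(1/p) this is
    at most \<epsilon> / 2 once L^(1/p) is at least \<open>Q\<close>.\<close>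
  define Q where "Q = 32 * s * R / \<epsilon>"
  define L where "L = nat \<lceil>Q powr p\<rceil> + 1"
  have Q: "0 < Q"
    using s R \<epsilon> by (simp add: Q_def)
  have "Q powr p \<le> real L"
    by (simp add: L_def) linarith
  then have "(Q powr p) powr (1 / p) \<le> real L powr (1 / p)"
    using p by (intro powr_mono2) auto
  then have QL: "Q \<le> real L powr (1 / p)"
    using p Q by (simp add: powr_powr)
  have L0: "0 < L"
    by (simp add: L_def)
  define t where "t = R / real L powr (1 / p)"
  have t: "0 < t" and Lt: "real L powr (1 / p) * t = R"
    using R by (auto simp: t_def L0)
  have "t * Q \<le> t * real L powr (1 / p)"
    using t by (intro mult_left_mono QL) simp
  also have "\<dots> = R"
    using Lt by (simp only: mult.commute)
  finally have st: "16 * s * t \<le> \<epsilon> / 2"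
    using \<epsilon> s R by (simp add: Q_def field_simps)
  define v where "v j = (if M \<le> j \<and> j < M + L then t * cis \<theta> ^ j else 0)" for j
  define u where "u = spread e v"
  have nv: "norm (v j) \<le> t" for j
    using t by (simp add: v_def norm_mult norm_power)
  have u: "u \<in> lp p" "lp_norm p u \<le> R"
    using lp_spread[OF p, of e "{M..<M + L}" v t] nv t e by (auto simp: u_def v_def Lt)
  have uR: "R \<le> lp_norm p u"
    using le_lp_norm_spread[OF p, of e v "{M..<M + L}" t] u t
    by (auto simp: u_def Lt v_def norm_mult norm_power)
  \<comment> \<open>Deviations from the limits are cut off below \<open>M0\<close>, so that they are
    bounded by \<delta> everywhere. The cut changes nothing on \<open>u\<close>, which is supported
    beyond \<open>M0\<close>.\<close>
  define tail where "tail f k = spread e (\<lambda>j. if M0 \<le> j then f (2 * j + e) - k else 0)"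
    for f :: "nat \<Rightarrow> complex" and k
  define g where "g j = s * (if j = 0 then 0 else v (j - 1)) + d * v j + s * v (j + 1)" for j
  have split: "op_T a b c u = op_T (tail a d) (tail b s) (tail c s) u + spread e g"
  proof
    fix n
    show "op_T a b c u n = (op_T (tail a d) (tail b s) (tail c s) u + spread e g) n"
    proof (cases "\<exists>j. n = 2 * j + e")
      case True
      then obtain j where n: "n = 2 * j + e"
        by blast
      have "v j \<noteq> 0 \<Longrightarrow> M0 \<le> j" "v (j + 1) \<noteq> 0 \<Longrightarrow> M0 \<le> j" "j \<noteq> 0 \<Longrightarrow> v (j - 1) \<noteq> 0 \<Longrightarrow> M0 \<le> j - 1"
        by (auto simp: v_def M_def split: if_splits)
      then show ?thesis
        unfolding u_def op_T_spread[OF e] n plus_fun_apply tail_def spread_apply g_def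
        by (cases "v j = 0"; cases "v (j + 1) = 0"; cases "v (j - 1) = 0")
          (auto simp: algebra_simps)
    next
      case False
      then show ?thesis
        unfolding u_def op_T_spread[OF e] plus_fun_apply using spread_eq_0[of n e] by auto
    qed
  qed
  have tail: "norm (tail a d n) \<le> \<delta>" "norm (tail b s n) \<le> \<delta>" "norm (tail c s n) \<le> \<delta>" for n
    unfolding tail_def using M0 \<delta>
    by - (rule norm_spread_le; simp add: less_imp_le)+
  note small = op_T_bounded[of p u "tail a d" \<delta> "tail b s" \<delta> "tail c s" \<delta>, OF p u(1) tail]
  have "(\<delta> + \<delta> + \<delta>) * lp_norm p u \<le> (\<delta> + \<delta> + \<delta>) * R"
    using u \<delta> by (intro mult_left_mono) auto
  also have "\<dots> = \<epsilon> / 2"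
    using R by (simp add: \<delta>_def field_simps)
  finally have small': "lp_norm p (op_T (tail a d) (tail b s) (tail c s) u) \<le> \<epsilon> / 2"
    using small(2) by simp
  \<comment> \<open>Away from the two ends of the support, a row sees either three consecutive wave
    values, which cancel, or only zeros.\<close>
  have g0: "g j = 0" if j: "j \<notin> {M - 1, M, M + L - 1, M + L}" for j
  proof (cases "M < j \<and> j < M + L - 1")
    case True
    then obtain i where i: "j = Suc i"
      by (cases j) auto
    have "v i = t * cis \<theta> ^ i" "v (Suc i) = t * cis \<theta> ^ Suc i"
      "v (Suc (Suc i)) = t * cis \<theta> ^ Suc (Suc i)"
      using True i unfolding v_def by (simp_all del: power_Suc) linarith+
    then have "g j = s * t * (cis \<theta> ^ i - 2 * complex_of_real (cos \<theta>) * cis \<theta> ^ Suc i + cis \<theta> ^ Suc (Suc i))"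
      using i by (simp add: g_def d_def algebra_simps)
    then show ?thesis
      by (simp only: cis_recurrence mult_zero_right)
  next
    case False
    then have "j + 1 < M \<or> M + L < j"
      using j by (auto simp: M_def)
    then show ?thesis
      by (auto simp: g_def v_def)
  qed
  have gb: "norm (g j) \<le> 4 * s * t" for j
  proof -
    have "norm d \<le> 2 * s"
      using s abs_cos_le_one[of \<theta>] by (simp add: d_def norm_mult)
    then have 1: "norm (d * v j) \<le> 2 * s * t"
      using nv[of j] s by (simp add: norm_mult mult_mono)
    have 2: "norm (s * v i) \<le> s * t" for i
      using nv[of i] s by (simp add: norm_mult)
    have 3: "norm (s * (if j = 0 then 0 else v (j - 1))) \<le> s * t"
      using 2[of "j - 1"] s t by auto
    have "norm (g j) \<le> s * t + 2 * s * t + s * t"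
      unfolding g_def by (intro norm_triangle_mono 1 2 3)
    then show ?thesis
      by simp
  qed
  define S where "S = {M - 1, M, M + L - 1, M + L}"
  have sg: "spread e g \<in> lp p" "lp_norm p (spread e g) \<le> real (card S) powr (1 / p) * (4 * s * t)"
    using lp_spread[OF p, of e S g "4 * s * t"] g0 gb s t e by (auto simp: S_def)
  have "card S \<le> 4"
    unfolding S_def using card_length[of "[M - 1, M, M + L - 1, M + L]"] by simp
  then have "real (card S) powr (1 / p) \<le> 4 powr (1 / p)"
    using p by (intro powr_mono2) auto
  also have "\<dots> \<le> 4 powr 1"
    using p by (intro powr_mono) auto
  finally have "real (card S) powr (1 / p) * (4 * s * t) \<le> 4 * (4 * s * t)"
    using s t by (intro mult_right_mono) auto
  then have sg': "lp_norm p (spread e g) \<le> \<epsilon> / 2"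
    using sg(2) st by linarith
  have "lp_norm p (op_T a b c u) \<le> \<epsilon>"
    unfolding split using lp_norm_triangle[OF p small(1) sg(1)] small' sg' by linarith
  moreover have "\<exists>j. n = 2 * j + e \<and> N \<le> j \<and> j < M + L" if un: "u n \<noteq> 0" for n
  proof -
    obtain j where "n = 2 * j + e"
      using spread_eq_0[of n e v] un unfolding u_def by blast
    then show ?thesis
      using un by (auto simp: u_def v_def M_def split: if_splits)
  qed
  ultimately show ?thesis
    using u(1) uR by (intro exI[of _ u] exI[of _ "M + L"]) (auto simp: M_def)
qed

text \<open>Each entry of the image involves at most three entries of the argument, so pointwise
  convergence is enough. This allows sums \<open>w\<close> that lie outside
  \<open>lp p\<close>.\<close>

lemma op_T_sums:
  assumes "\<And>n. (\<lambda>k. v k n) sums w n"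
  shows "(\<lambda>k. op_T a b c (v k) n) sums op_T a b c w n"
proof (cases "n = 0")
  case False
  have "(\<lambda>k. (if n \<le> 2 then 0 else c (n - 2) * v k (n - 2)) + a n * v k n + b n * v k (n + 2)) sums
      ((if n \<le> 2 then 0 else c (n - 2) * w (n - 2)) + a n * w n + b n * w (n + 2))"
    by (cases "n \<le> 2") (simp_all add: sums_add sums_mult assms)
  then show ?thesis
    using False by (simp add: op_T_def)
qed (simp add: op_T_def)

text \<open>Row n determines entry n + 2 from earlier entries of the same class, because
  \<open>b n\<close> can be divided out. A formal solution is thus fixed on the class by its entry
  at \<open>e\<close>.\<close>

lemma op_T_kernel_parity:
  assumes e: "e \<in> {1, 2}" and b: "\<And>n. 1 \<le> n \<Longrightarrow> b n \<noteq> 0"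
    and h: "op_T a b c h = 0" "h e = 0"
  shows "h (2 * j + e) = 0"
proof (induction j rule: less_induct)
  case (less j)
  show ?case
  proof (cases j)
    case (Suc i)
    have "op_T a b c h (2 * i + e) = 0"
      by (simp add: h)
    moreover have "h (2 * i + e) = 0"
      using less Suc by simp
    moreover have "h (2 * i + e - 2) = 0" if "2 < 2 * i + e"
      using less[of "i - 1"] Suc that e by (cases i) auto
    ultimately have "b (2 * i + e) * h (2 * i + e + 2) = 0"
      using e by (auto simp: op_T_def split: if_splits)
    then show ?thesis
      using b[of "2 * i + e"] e Suc by auto
  qed (use h in simp)
qed

lemma weyl_humps:
  fixes s \<theta> :: real
  assumes p: "1 < p" and e: "e \<in> {1, 2}" and s: "0 < s"
    and a: "(\<lambda>j. a (2 * j + e)) \<longlonglongrightarrow> - 2 * complex_of_real s * complex_of_real (cos \<theta>)"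
    and b: "(\<lambda>j. b (2 * j + e)) \<longlonglongrightarrow> complex_of_real s"
    and c: "(\<lambda>j. c (2 * j + e)) \<longlonglongrightarrow> complex_of_real s"
  obtains v where "\<And>k. v k \<in> lp p" "\<And>k n. v k n \<noteq> 0 \<Longrightarrow> \<exists>j. n = 2 * j + e"
    "\<And>k l n. v k n \<noteq> 0 \<Longrightarrow> v l n \<noteq> 0 \<Longrightarrow> k = l" "\<And>k. real k + 1 \<le> lp_norm p (v k)"
    "\<And>k. lp_norm p (op_T a b c (v k)) \<le> (1 / 2) ^ k"
proof -
  have "\<exists>u K. u \<in> lp p \<and> N \<le> K \<and> (\<forall>n. u n \<noteq> 0 \<longrightarrow> (\<exists>j. n = 2 * j + e \<and> N \<le> j \<and> j < K))
      \<and> real k + 1 \<le> lp_norm p u \<and> lp_norm p (op_T a b c u) \<le> (1 / 2) ^ k" for N k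
    by (rule weyl_hump[OF p e s a b c]) auto
  then obtain U H where U: "\<And>N k. U N k \<in> lp p" "\<And>N k. N \<le> H N k"
    "\<And>N k n. U N k n \<noteq> 0 \<Longrightarrow> \<exists>j. n = 2 * j + e \<and> N \<le> j \<and> j < H N k"
    "\<And>N k. real k + 1 \<le> lp_norm p (U N k)" "\<And>N k. lp_norm p (op_T a b c (U N k)) \<le> (1 / 2) ^ k"
    by metis
  \<comment> \<open>Hump k is placed in the window from \<open>K k\<close> up to
    \<open>K (Suc k)\<close>, each window starting where the previous one ends.\<close>
  define K where "K = rec_nat 0 (\<lambda>k m. H m k)"
  have K: "K (Suc k) = H (K k) k" for k
    by (simp add: K_def)
  have mono: "mono K"
    unfolding mono_iff_le_Suc K using U(2) by blast
  define v where "v k = U (K k) k" for k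
  have supp: "\<exists>j. n = 2 * j + e \<and> K k \<le> j \<and> j < K (Suc k)" if "v k n \<noteq> 0" for k n
    using U(3) that unfolding v_def K by blast
  have disj: "k = l" if v: "v k n \<noteq> 0" "v l n \<noteq> 0" for k l n
  proof -
    obtain j where j: "n = 2 * j + e" "K k \<le> j" "j < K (Suc k)"
      using supp[OF v(1)] by blast
    then have j': "K l \<le> j" "j < K (Suc l)"
      using supp[OF v(2)] by auto
    have "\<not> k < l" "\<not> l < k"
      using j j' monoD[OF mono, of "Suc k" l] monoD[OF mono, of "Suc l" k] by auto
    then show ?thesis
      by simp
  qed
  show thesis
  proof (rule that[of v])
    show "v k \<in> lp p" "real k + 1 \<le> lp_norm p (v k)" "lp_norm p (op_T a b c (v k)) \<le> (1 / 2) ^ k" for k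
      unfolding v_def by (rule U)+
    show "\<exists>j. n = 2 * j + e" if "v k n \<noteq> 0" for k n
      using supp[OF that] by blast
  qed (rule disj)
qed

text \<open>
  Glue humps \<open>v k\<close> with disjoint supports, growing norms and \<open>\<Sum>k. op_T a b c (v k)\<close> absolutely
  convergent. If the range is closed, the images of the two formal series \<open>w 0\<close> (even \<open>k\<close>) and
  \<open>w 1\<close> (odd \<open>k\<close>) are images of some \<open>x 0\<close> and \<open>x 1\<close> in \<open>lp p\<close>. The differences \<open>x i - w i\<close> solve
  a recurrence with a one-dimensional solution space in the given parity class, so that some
  nontrivial combination of \<open>w 0\<close> and \<open>w 1\<close> agrees there with an element of \<open>lp p\<close>, although the
  humps are unbounded.
\<close>

lemma op_T_range_not_closed:
  fixes s \<theta> :: real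
  assumes p: "1 < p" and e: "e \<in> {1, 2}" and s: "0 < s"
    and a: "(\<lambda>j. a (2 * j + e)) \<longlonglongrightarrow> - 2 * complex_of_real s * complex_of_real (cos \<theta>)"
    and b: "(\<lambda>j. b (2 * j + e)) \<longlonglongrightarrow> complex_of_real s"
    and c: "(\<lambda>j. c (2 * j + e)) \<longlonglongrightarrow> complex_of_real s"
    and b_nz: "\<And>n. 1 \<le> n \<Longrightarrow> b n \<noteq> 0"
    and A: "op_T a b c \<in> lp_ops p"
  shows "\<not> closedin (Metric_space.mtopology (lp p) (lp_dist p)) (lp_range p (op_T a b c))"
proof
  assume closed: "closedin (Metric_space.mtopology (lp p) (lp_dist p)) (lp_range p (op_T a b c))"
  obtain v where v: "\<And>k. v k \<in> lp p" and supp: "\<And>k n. v k n \<noteq> 0 \<Longrightarrow> \<exists>j. n = 2 * j + e"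
    and disj: "\<And>k l n. v k n \<noteq> 0 \<Longrightarrow> v l n \<noteq> 0 \<Longrightarrow> k = l"
    and large: "\<And>k. real k + 1 \<le> lp_norm p (v k)"
    and small: "\<And>k. lp_norm p (op_T a b c (v k)) \<le> (1 / 2) ^ k"
    using weyl_humps[OF p e s a b c] by metis
  define T where "T = op_T a b c"
  \<comment> \<open>At each n at most one hump is nonzero, so this series is a finite sum
    there.\<close>
  define w where "w i n = (\<Sum>k. v (2 * k + i) n)" for i n
  have w_sums: "(\<lambda>k. v (2 * k + i) n) sums w i n" for i n
  proof -
    have "finite {k. v (2 * k + i) n \<noteq> 0}"
    proof (cases "\<exists>l. v (2 * l + i) n \<noteq> 0")
      case True
      then obtain l where l: "v (2 * l + i) n \<noteq> 0"
        by blast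
      have "{k. v (2 * k + i) n \<noteq> 0} \<subseteq> {l}"
        using disj[OF _ l] by force
      then show ?thesis
        using finite_subset by blast
    qed simp
    then show ?thesis
      unfolding w_def by (intro summable_sums summable_finite[of "{k. v (2 * k + i) n \<noteq> 0}"]) auto
  qed
  have w_val: "w i n = (if m mod 2 = i then v m n else 0)" if m: "v m n \<noteq> 0" and i: "i < 2" for i m n
  proof (cases "m mod 2 = i")
    case True
    have "v (2 * k + i) n = (if k = m div 2 then v m n else 0)" for k
    proof (cases "k = m div 2")
      case False
      then have "2 * k + i \<noteq> m"
        using i by auto
      then show ?thesis
        using disj[OF _ m, of "2 * k + i"] False by auto
    qed (use True in auto)
    then have "(\<lambda>k. v (2 * k + i) n) sums v m n"
      using sums_single[of "m div 2" "\<lambda>_. v m n"] by simp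
    then show ?thesis
      using True sums_unique2[OF w_sums] by simp
  next
    case False
    then have "2 * k + i \<noteq> m" for k
      using i by auto
    then have "v (2 * k + i) n = 0" for k
      using disj[OF _ m, of "2 * k + i"] by blast
    then show ?thesis
      using False by (simp add: w_def)
  qed
  have ex: "\<exists>x\<in>lp p. T x = T (w i)" for i
  proof -
    have Tv: "T (v (2 * k + i)) \<in> lp p" for k
      unfolding T_def by (rule lp_opsD(1)[OF p A v])
    have sum: "summable (\<lambda>k. lp_norm p (T (v (2 * k + i))))"
    proof (rule summable_comparison_test'[where N = 0 and g = "\<lambda>k. (1 / 2) ^ k"])
      show "summable (\<lambda>k. (1 / 2) ^ k :: real)"
        by (rule summable_geometric) simp
      show "norm (lp_norm p (T (v (2 * k + i)))) \<le> (1 / 2) ^ k" for k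
        using order_trans[OF small power_decreasing[of k "2 * k + i" "1 / 2 :: real"]]
        by (simp add: T_def)
    qed
    define f where "f m = (\<lambda>n. \<Sum>k<m. T (v (2 * k + i)) n)" for m
    have Tw: "(\<lambda>n. \<Sum>k. T (v (2 * k + i)) n) = T (w i)"
    proof
      fix n
      have "(\<lambda>k. T (v (2 * k + i)) n) sums T (w i) n"
        unfolding T_def by (intro op_T_sums w_sums)
      then show "(\<Sum>k. T (v (2 * k + i)) n) = T (w i) n"
        by (simp add: sums_iff)
    qed
    have "f m = T (\<lambda>n. \<Sum>k<m. v (2 * k + i) n)" for m
      unfolding f_def T_def by (rule lp_ops_sum[OF p A v, symmetric])
    then have "f m \<in> lp_range p T" for m
      unfolding lp_range_def using lp_sum(1)[OF p v] by auto
    moreover have "T (w i) \<in> lp p" "(\<lambda>m. lp_norm p (f m - T (w i))) \<longlonglongrightarrow> 0"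
      using lp_series_bound(2)[OF p Tv sum] lp_series_tendsto[OF p Tv sum] by (simp_all add: Tw f_def)
    ultimately have "T (w i) \<in> lp_range p T"
      using closed unfolding lp_closedin_iff[OF p] T_def by blast
    then show ?thesis
      by (auto simp: lp_range_def)
  qed
  obtain x where x: "\<And>i. x i \<in> lp p" "\<And>i. T (x i) = T (w i)"
    using ex by metis
  define h where "h i = x i - w i" for i
  have h: "T (h i) = 0" for i
    using x(2) by (simp add: h_def T_def op_T_diff)
  have h_eq: "x i n = w i n + h i n" for i n
    by (simp add: h_def)
  \<comment> \<open>Hump m has norm at least m + 1, so no single vector of \<open>lp p\<close>
    dominates, up to a fixed factor, all humps whose index has a given parity. All three
    contradictions below have this form.\<close>
  have unbounded: False if z: "z \<in> lp p" and C: "0 \<le> C" and i: "i < 2"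
    and le: "\<And>m n. m mod 2 = i \<Longrightarrow> v m n \<noteq> 0 \<Longrightarrow> norm (v m n) \<le> C * norm (z n)" for z C i
  proof -
    obtain k :: nat where k: "C * lp_norm p z < k"
      using reals_Archimedean2 by blast
    define m where "m = 2 * k + i"
    have "lp_norm p (v m) \<le> C * lp_norm p z"
    proof (rule lp_reindex(2)[OF p z C, where S = UNIV and f = "\<lambda>n. n"])
      show "norm (v m n) \<le> C * norm (z n)" for n
        using le[of m n] C i by (cases "v m n = 0") (auto simp: m_def)
    qed (use lp_at_0[OF v] in auto)
    then show False
      using large[of m] k by (simp add: m_def)
  qed
  \<comment> \<open>The weights are chosen so that the same combination \<open>k\<close> of
    \<open>h 0\<close> and \<open>h 1\<close> vanishes at \<open>e\<close>, hence on the whole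
    class. There \<open>z\<close> is a combination of the two formal series alone.\<close>
  define z where "z = seq_scale (h 1 e) (x 0) - seq_scale (h 0 e) (x 1)"
  have z: "z \<in> lp p"
    unfolding z_def by (intro lp_diff[OF p] lp_scale x)
  define k where "k = seq_scale (h 1 e) (h 0) - seq_scale (h 0 e) (h 1)"
  have "T k = 0" "k e = 0"
    using h by (simp_all add: k_def T_def op_T_diff op_T_scale) (simp add: seq_scale_def)
  then have "k (2 * j + e) = 0" for j
    using op_T_kernel_parity[of e b a c k, OF e b_nz] by (simp add: T_def)
  then have z_val: "z (2 * j + e) = h 1 e * w 0 (2 * j + e) - h 0 e * w 1 (2 * j + e)" for j
    by (simp add: z_def k_def h_eq seq_scale_def algebra_simps)
  \<comment> \<open>On the support of an even-indexed hump \<open>w 1\<close> vanishes, so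
    \<open>z\<close> is that hump times \<open>h 1 e\<close>; a nonzero factor would let
    \<open>z\<close> dominate all of them. Odd-indexed humps treat \<open>h 0 e\<close>
    alike.\<close>
  have h1: "h 1 e = 0"
  proof (rule ccontr)
    assume nz: "h 1 e \<noteq> 0"
    show False
    proof (rule unbounded[OF z, of "1 / norm (h 1 e)" 0])
      fix m n :: nat
      assume m: "m mod 2 = 0" "v m n \<noteq> 0"
      obtain j where "n = 2 * j + e"
        using supp[OF m(2)] by blast
      then have "z n = h 1 e * v m n"
        using z_val[of j] w_val[OF m(2)] m(1) by simp
      then show "norm (v m n) \<le> 1 / norm (h 1 e) * norm (z n)"
        using nz by (simp add: norm_mult)
    qed auto
  qed
  have h0: "h 0 e = 0"
  proof (rule ccontr)
    assume nz: "h 0 e \<noteq> 0"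
    show False
    proof (rule unbounded[OF z, of "1 / norm (h 0 e)" 1])
      fix m n :: nat
      assume m: "m mod 2 = 1" "v m n \<noteq> 0"
      obtain j where "n = 2 * j + e"
        using supp[OF m(2)] by blast
      then have "z n = - h 0 e * v m n"
        using z_val[of j] w_val[OF m(2)] m(1) by simp
      then show "norm (v m n) \<le> 1 / norm (h 0 e) * norm (z n)"
        using nz by (simp add: norm_mult)
    qed auto
  qed
  \<comment> \<open>In the remaining case the combination \<open>z\<close> carries no information,
    but \<open>h 0\<close> itself vanishes on the class, so \<open>x 0\<close> agrees with
    \<open>w 0\<close> there.\<close>
  have "h 0 (2 * j + e) = 0" for j
    using op_T_kernel_parity[of e b a c "h 0", OF e b_nz] h h0 by (simp add: T_def)
  then have x_val: "x 0 (2 * j + e) = w 0 (2 * j + e)" for j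
    by (simp add: h_eq)
  show False
  proof (rule unbounded[OF x(1), of 1 0 0])
    fix m n :: nat
    assume m: "m mod 2 = 0" "v m n \<noteq> 0"
    obtain j where "n = 2 * j + e"
      using supp[OF m(2)] by blast
    then show "norm (v m n) \<le> 1 * norm (x 0 n)"
      using x_val[of j] w_val[OF m(2)] m(1) by simp
  qed auto
qed

section \<open>The essential spectrum\<close>

lemma tendsto_parity:
  fixes f :: "nat \<Rightarrow> complex"
  assumes odd: "(\<lambda>n. f (2 * n - 1)) \<longlonglongrightarrow> u" and even: "(\<lambda>n. f (2 * n)) \<longlonglongrightarrow> v"
  shows "(\<lambda>n. f n - parity_seq u v n) \<longlonglongrightarrow> 0"
proof (rule tendstoI)
  fix \<epsilon> :: real
  assume "0 < \<epsilon>"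
  then have "\<forall>\<^sub>F n in sequentially. dist (f (2 * n - 1)) u < \<epsilon> \<and> dist (f (2 * n)) v < \<epsilon>"
    by (intro eventually_conj tendstoD[OF odd] tendstoD[OF even])
  then obtain N where N: "\<And>n. N \<le> n \<Longrightarrow> dist (f (2 * n - 1)) u < \<epsilon>"
    "\<And>n. N \<le> n \<Longrightarrow> dist (f (2 * n)) v < \<epsilon>"
    by (auto simp: eventually_sequentially)
  have "dist (f n - parity_seq u v n) 0 < \<epsilon>" if n: "2 * N \<le> n" for n
  proof (cases "odd n")
    case True
    then obtain k where "n = 2 * k + 1"
      by (auto elim: oddE)
    then show ?thesis
      using N(1)[of "k + 1"] n by (simp add: parity_seq_def dist_norm)
  next
    case False
    then obtain k where "n = 2 * k"
      by (auto elim: evenE)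
    then show ?thesis
      using N(2)[of k] n by (simp add: parity_seq_def dist_norm)
  qed
  then show "\<forall>\<^sub>F n in sequentially. dist (f n - parity_seq u v n) 0 < \<epsilon>"
    by (auto simp: eventually_sequentially)
qed

lemma op_T0_eq_op_T:
  "op_T0 r1 r2 s1 s2 = op_T (parity_seq r1 r2) (parity_seq s1 s2) (parity_seq s1 s2)"
  by (auto simp: op_T0_def op_T_def parity_seq_def fun_eq_iff Let_def)

lemma shifted_op_T:
  assumes "x \<in> lp p"
  shows "shifted (op_T a b c) z x = op_T (\<lambda>n. a n - z) b c x"
  using lp_at_0[OF assms] by (auto simp: shifted_def op_T_def seq_scale_def fun_eq_iff algebra_simps)

lemma not_fredholm_in_interval:
  fixes r s t :: real
  assumes p: "1 < p" and e: "e \<in> {1, 2}" and s: "0 < s"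
    and a: "(\<lambda>j. a (2 * j + e)) \<longlonglongrightarrow> complex_of_real r"
    and b: "(\<lambda>j. b (2 * j + e)) \<longlonglongrightarrow> complex_of_real s"
    and c: "(\<lambda>j. c (2 * j + e)) \<longlonglongrightarrow> complex_of_real s"
    and b_nz: "\<And>n. 1 \<le> n \<Longrightarrow> b n \<noteq> 0"
    and t: "t \<in> {r - 2 * s..r + 2 * s}"
  shows "\<not> lp_fredholm p (op_T (\<lambda>n. a n - complex_of_real t) b c)"
proof
  assume F: "lp_fredholm p (op_T (\<lambda>n. a n - complex_of_real t) b c)"
  \<comment> \<open>Solves t = r + 2 s cos \<theta>, so the shifted diagonal tends to - 2 s cos
    \<theta>. The endpoints of the interval are included, as cosine values 1 and -1.\<close>
  define \<theta> where "\<theta> = arccos ((t - r) / (2 * s))"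
  have "cos \<theta> = (t - r) / (2 * s)"
    unfolding \<theta>_def using s t by (intro cos_arccos) (auto simp: field_simps)
  then have "r - t = - 2 * s * cos \<theta>"
    using s by simp
  then have "complex_of_real r - complex_of_real t = - 2 * complex_of_real s * complex_of_real (cos \<theta>)"
    by (metis of_real_diff of_real_minus of_real_mult of_real_numeral)
  then have "(\<lambda>j. a (2 * j + e) - complex_of_real t) \<longlonglongrightarrow> - 2 * complex_of_real s * complex_of_real (cos \<theta>)"
    using tendsto_diff[OF a tendsto_const] by metis
  from op_T_range_not_closed[OF p e s this b c b_nz] F show False
    by (simp add: lp_fredholm_def)
qed

theorem corollary4p4:
  fixes p r1 r2 s1 s2 :: real and a b c :: "nat \<Rightarrow> complex"
  assumes "1 < p"
    and "0 \<le> r1" and "0 \<le> r2" and "0 < s1" and "0 < s2"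
    and "\<And>n. 1 \<le> n \<Longrightarrow> b n \<noteq> 0" and "\<And>n. 1 \<le> n \<Longrightarrow> c n \<noteq> 0"
    and "(\<lambda>n. a (2 * n - 1)) \<longlonglongrightarrow> complex_of_real r1"
    and "(\<lambda>n. b (2 * n - 1)) \<longlonglongrightarrow> complex_of_real s1"
    and "(\<lambda>n. c (2 * n - 1)) \<longlonglongrightarrow> complex_of_real s1"
    and "(\<lambda>n. a (2 * n)) \<longlonglongrightarrow> complex_of_real r2"
    and "(\<lambda>n. b (2 * n)) \<longlonglongrightarrow> complex_of_real s2"
    and "(\<lambda>n. c (2 * n)) \<longlonglongrightarrow> complex_of_real s2"
  shows "lp_ess_spectrum p (op_T a b c) = lp_spectrum p (op_T0 r1 r2 s1 s2)
    \<and> lp_spectrum p (op_T0 r1 r2 s1 s2)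
      = complex_of_real ` ({r1 - 2 * s1..r1 + 2 * s1} \<union> {r2 - 2 * s2..r2 + 2 * s2})"
proof -
  note p = assms(1) and s = assms(4,5)
  define E where "E = complex_of_real ` ({r1 - 2 * s1..r1 + 2 * s1} \<union> {r2 - 2 * s2..r2 + 2 * s2})"
  define a0 where "a0 = parity_seq r1 r2"
  define s0 where "s0 = parity_seq s1 s2"
  have ess: "z \<in> lp_ess_spectrum p (op_T a b c) \<longleftrightarrow> \<not> lp_fredholm p (op_T (\<lambda>n. a n - z) b c)"
    for z and a b c :: "nat \<Rightarrow> complex"
    unfolding lp_ess_spectrum_def mem_Collect_eq
    by (subst lp_fredholm_cong[OF p shifted_op_T]) auto
  have spec: "z \<in> lp_spectrum p (op_T a b c) \<longleftrightarrow> \<not> lp_invertible p (op_T (\<lambda>n. a n - z) b c)"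
    for z and a b c :: "nat \<Rightarrow> complex"
    unfolding lp_spectrum_def mem_Collect_eq
    by (subst lp_invertible_cong[OF p shifted_op_T]) auto
  \<comment> \<open>Advancing the index by one removes the truncated subtraction at n = 0 and gives
    the form 2 j + e with \<open>e = 1\<close>; the even case gives \<open>e = 2\<close>.\<close>
  have odd_shift: "(\<lambda>j. f (2 * j + 1)) \<longlonglongrightarrow> l" if "(\<lambda>n. f (2 * n - 1)) \<longlonglongrightarrow> l"
    for f :: "nat \<Rightarrow> complex" and l
    using LIMSEQ_Suc[OF that] by simp
  have even_shift: "(\<lambda>j. f (2 * j + 2)) \<longlonglongrightarrow> l" if "(\<lambda>n. f (2 * n)) \<longlonglongrightarrow> l"
    for f :: "nat \<Rightarrow> complex" and l
    using LIMSEQ_Suc[OF that] by simp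
  \<comment> \<open>Kept general in the coefficients, because it is applied both to the given ones
    and to their parity-periodic limits.\<close>
  have inside: "\<not> lp_fredholm p (op_T (\<lambda>n. a n - z) b c)"
    if z: "z \<in> E" and b: "\<And>n. 1 \<le> n \<Longrightarrow> b n \<noteq> 0"
      and odd: "(\<lambda>j. a (2 * j + 1)) \<longlonglongrightarrow> complex_of_real r1" "(\<lambda>j. b (2 * j + 1)) \<longlonglongrightarrow> complex_of_real s1"
        "(\<lambda>j. c (2 * j + 1)) \<longlonglongrightarrow> complex_of_real s1"
      and even: "(\<lambda>j. a (2 * j + 2)) \<longlonglongrightarrow> complex_of_real r2" "(\<lambda>j. b (2 * j + 2)) \<longlonglongrightarrow> complex_of_real s2"
        "(\<lambda>j. c (2 * j + 2)) \<longlonglongrightarrow> complex_of_real s2"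
    for z and a b c :: "nat \<Rightarrow> complex"
  proof -
    obtain t where "z = complex_of_real t" "t \<in> {r1 - 2 * s1..r1 + 2 * s1} \<or> t \<in> {r2 - 2 * s2..r2 + 2 * s2}"
      using z by (auto simp: E_def)
    then show ?thesis
      using not_fredholm_in_interval[OF p _ s(1) odd b, of t] not_fredholm_in_interval[OF p _ s(2) even b, of t]
      by auto
  qed
  have outside: "lp_invertible p (op_T (\<lambda>n. a0 n - z) s0 s0)" if "z \<notin> E" for z
    using lp_invertible_outside_intervals[OF p s] that unfolding E_def a0_def s0_def by blast
  have T_inside: "\<not> lp_fredholm p (op_T (\<lambda>n. a n - z) b c)" if "z \<in> E" for z
    by (intro inside that odd_shift even_shift assms)
  have T0_inside: "\<not> lp_invertible p (op_T (\<lambda>n. a0 n - z) s0 s0)" if "z \<in> E" for z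
  proof -
    have "\<not> lp_fredholm p (op_T (\<lambda>n. a0 n - z) s0 s0)"
      by (rule inside[OF that]) (use s in \<open>auto simp: a0_def s0_def parity_seq_def\<close>)
    then show ?thesis
      using lp_invertible_imp_fredholm[OF p] by blast
  qed
  have T_outside: "lp_fredholm p (op_T (\<lambda>n. a n - z) b c)" if "z \<notin> E" for z
  proof -
    have "lp_fredholm p (\<lambda>x. op_T (\<lambda>n. a0 n - z) s0 s0 x
        + op_T (\<lambda>n. a n - a0 n) (\<lambda>n. b n - s0 n) (\<lambda>n. c n - s0 n) x)"
      unfolding a0_def s0_def
      by (intro lp_fredholm_op_T_perturbation[OF p outside[OF that, unfolded a0_def s0_def]]
          tendsto_parity assms)
    then show ?thesis
      unfolding op_T_coeff_add[symmetric] by simp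
  qed
  have "lp_ess_spectrum p (op_T a b c) = E"
    using ess[of _ a b c] T_inside T_outside by blast
  moreover have "lp_spectrum p (op_T0 r1 r2 s1 s2) = E"
    unfolding op_T0_eq_op_T a0_def[symmetric] s0_def[symmetric]
    using spec[of _ a0 s0 s0] T0_inside outside by blast
  ultimately show ?thesis
    unfolding E_def by simp
qed

end
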